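(* Let $V$ be a reflexive Banach space, $X$ a Banach space, $\gamma\in\mathcal{L}(V,X)$ a linear and continuous operator with $c_\gamma:=\|\gamma\|_{\mathcal{L}(V,X)}$ and adjoint $\gamma^*\colon X^*\to V^*$, and $T>0$. Let $A,B\colon V\to V^*$, $J\colon X\times X\to\mathbb{R}$, $f\colon[0,T]\to V^*$ and $u_0$ satisfy: (A) $A$ is linear and bounded, symmetric, and there is $m_A>0$ with $\langle Au,u\rangle_{V^*\times V}\ge m_A\|u\|_V^2$ for all $u\in V$; (B) there is $L_B>0$ with $\|Bv-Bw\|_{V^*}\le L_B\|v-w\|_V$ for all $v,w\in V$; (J) $J(w,\cdot)$ is locally Lipschitz continuous for all $w\in X$; there are $c_0,c_1,c_2\ge 0$ such that $\|\partial_2J(w,v)\|_{X^*}\le c_0+c_1\|w\|_X+c_2\|v\|_X$ for all $w,v\in X$; and there are $m_{J1},m_{J2}\ge0$ such that $$J_2^0(w_1,v_1;v_2-v_1)+J_2^0(w_2,v_2;v_1-v_2)\le m_{J1}\|v_1-v_2\|_X^2+m_{J2}\|w_1-w_2\|_X\|v_1-v_2\|_X$$ for all $w_1,w_2,v_1,v_2\in X$; (f) $f\in C([0,T];V^* )$; (u) $u_0\in V$; (s) $m_A-2m_{J1}c_\gamma^2>0$. Let $V^h\subset V$ be a finite dimensional space with discretization parameter $h>0$, let $u_0^h\in V^h$ be an approximation of $u_0$, and let $N\in\mathbb{N}$, $k=T/N$, $t_j=jk$ for $0\le j\le N$, $f_j=f(t_j)$. For $v^{hk}=\{v_j^{hk}\}_{j=1}^N\subset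 V^h$ put $(K^kv^{hk})_0=u_0^h$ and $(K^kv^{hk})_j=k\sum_{i=1}^jv_i^{hk}+u_0^h$ for $1\le j\le N$. Consider the following two problems. Problem $P^h_{incl}$: find $v^{hk}=\{v_j^{hk}\}_{j=1}^N\subset V^h$ such that for all $j\in\{1,\dots,N\}$ $$Av_j^{hk}+B(K^kv^{hk})_{j-1}+\gamma^*\partial_2J\big(\gamma(K^kv^{hk})_{j-1},\gamma v_j^{hk}\big)\ni f_j.$$ Problem $P^h_{opt}$: find $v^{hk}=\{v_j^{hk}\}_{j=1}^N\subset V^h$ such that for all $j\in\{1,\dots,N\}$ $$0\in\partial\mathcal{L}_j(v_j^{hk}),$$ where, with $(K^kv^{hk})_{j-1}$ regarded as given, the functional $\mathcal{L}_j\colon V\to\mathbb{R}$ is defined for all $w\in V$ by $$\mathcal{L}_j(w)=\tfrac12\langle Aw,w\rangle_{V^*\times V}+\langle B(K^kv^{hk})_{j-1}-f_j,w\rangle_{V^*\times V}+J(\gamma(K^kv^{hk})_{j-1},\gamma w).$$ Then Problems $P^h_{incl}$ and $P^h_{opt}$ are equivalent, have a unique solution $v^{hk}=\{v_j^{hk}\}_{j=1}^N\subset V^h$, and this solution satisfies $$\|v_j^{hk}\|_V\le c(1+\|f_j\|_{V^*}),\quad 1\le j\le N,$$ with a positive constant $c$.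
   Context: $V^*$ is the dual of $V$ and $\langle\cdot,\cdot\rangle_{V^*\times V}$ the duality pairing. For a locally Lipschitz $j\colon X\to\mathbb{R}$ on a normed space, $j^0(x;v)=\limsup_{y\to x,\lambda\searrow0}\frac{j(y+\lambda v)-j(y)}{\lambda}$ is the generalized directional derivative and $\partial j(x)=\{\xi\in X^*:\langle\xi,v\rangle_{X^*\times X}\le j^0(x;v)\ \forall v\in X\}$ the generalized (Clarke) subdifferential; for $\mathcal{L}_j$ it is taken on $V$, so $\partial\mathcal{L}_j(w)\subset V^*$. For $J\colon X\times X\to\mathbb{R}$, $J_2^0(w,v;z)$ and $\partial_2J(w,v)$ are the generalized directional derivative at $v$ in direction $z$, and the subdifferential at $v$, of $J(w,\cdot)$. A bound $\|\partial_2J(w,v)\|_{X^*}\le C$ means $\|\xi\|_{X^*}\le C$ for every $\xi\in\partial_2J(w,v)$. Symmetric means $\langle Au,v\rangle_{V^*\times V}=\langle Av,u\rangle_{V^*\times V}$ for all $u,v\in V$. The inclusion in Problem $P^h_{incl}$ means that there is $\zeta_j\in\partial_2J(\gamma(K^kv^{hk})_{j-1},\gamma v_j^{hk})$ with $Av_j^{hk}+B(K^kv^{hk})_{j-1}+\gamma^*\zeta_j=f_j$.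
   Formalization: Existence is false if the inclusions must hold in V^* with v_j in V^h (V=R, A=id, B=J=γ=0, f=1, V^h={0}); existence, uniqueness and the bound are proved with both problems tested only on V^h, while equivalence is proved both in V^* and on V^h. *)

theory Defs
  imports "HOL-Analysis.Analysis"
begin

text \<open>
  The dual of a normed space \<open>'v\<close> is the type \<open>'v \<Rightarrow>\<^sub>L real\<close> with its operator norm; the adjoint of
  \<open>\<gamma> :: 'v \<Rightarrow>\<^sub>L 'x\<close> sends \<open>\<zeta> :: 'x \<Rightarrow>\<^sub>L real\<close> to \<open>\<zeta> o\<^sub>L \<gamma>\<close>.
\<close>

definition reflexive_space :: "'v::real_normed_vector itself \<Rightarrow> bool" where
  "reflexive_space _ \<longleftrightarrow>
    (\<forall>\<phi> :: ('v \<Rightarrow>\<^sub>L real) \<Rightarrow>\<^sub>L real. \<exists>x. \<forall>\<xi>. blinfun_apply \<phi> \<xi> = blinfun_apply \<xi> x)"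

definition locally_lipschitz :: "('a::metric_space \<Rightarrow> real) \<Rightarrow> bool" where
  "locally_lipschitz j \<longleftrightarrow> (\<forall>x. \<exists>U L. open U \<and> x \<in> U \<and> L-lipschitz_on U j)"

text \<open>
  The limes superior is taken in the extended reals, so that it is meaningful for every \<open>j\<close>; it is
  finite when \<open>j\<close> is locally Lipschitz. The base point \<open>y\<close> may equal \<open>x\<close>.
\<close>

definition clarke_deriv :: "('a::real_normed_vector \<Rightarrow> real) \<Rightarrow> 'a \<Rightarrow> 'a \<Rightarrow> ereal" where
  "clarke_deriv j x v =
    Limsup (nhds x \<times>\<^sub>F at_right 0) (\<lambda>(y, t). ereal ((j (y + t *\<^sub>R v) - j y) / t))"

definition clarke_subdiff :: "('a::real_normed_vector \<Rightarrow> real) \<Rightarrow> 'a \<Rightarrow> ('a \<Rightarrow>\<^sub>L real) set" where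
  "clarke_subdiff j x = {\<xi>. \<forall>v. ereal (blinfun_apply \<xi> v) \<le> clarke_deriv j x v}"

definition finite_dim_subspace :: "'v::real_vector set \<Rightarrow> bool" where
  "finite_dim_subspace S \<longleftrightarrow> (\<exists>E. finite E \<and> S = span E)"

definition discrete_K :: "real \<Rightarrow> 'v::real_vector \<Rightarrow> (nat \<Rightarrow> 'v) \<Rightarrow> nat \<Rightarrow> 'v" where
  "discrete_K k u0h v j = k *\<^sub>R (\<Sum>i=1..j. v i) + u0h"

text \<open>The functional of one time step; \<open>u\<close> stands for the known value of \<open>discrete_K\<close>.\<close>

definition step_functional ::
  "('v::real_normed_vector \<Rightarrow> 'v \<Rightarrow>\<^sub>L real) \<Rightarrow> ('v \<Rightarrow> 'v \<Rightarrow>\<^sub>L real) \<Rightarrow>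
   ('x::real_normed_vector \<Rightarrow> 'x \<Rightarrow> real) \<Rightarrow> ('v \<Rightarrow>\<^sub>L 'x) \<Rightarrow> ('v \<Rightarrow>\<^sub>L real) \<Rightarrow> 'v \<Rightarrow> 'v \<Rightarrow> real" where
  "step_functional A B J \<gamma> fj u w =
    1 / 2 * blinfun_apply (A w) w + blinfun_apply (B u - fj) w
      + J (blinfun_apply \<gamma> u) (blinfun_apply \<gamma> w)"

text \<open>
  Equality of two functionals on the test space \<open>W\<close>: for \<open>W = UNIV\<close> this is equality in the dual of
  the whole space, for a finite dimensional \<open>W\<close> it is equality of the restrictions in the dual of \<open>W\<close>.
\<close>

definition eq_on_test :: "'v::real_normed_vector set \<Rightarrow> ('v \<Rightarrow>\<^sub>L real) \<Rightarrow> ('v \<Rightarrow>\<^sub>L real) \<Rightarrow> bool" where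
  "eq_on_test W \<xi> \<eta> \<longleftrightarrow> (\<forall>w\<in>W. blinfun_apply \<xi> w = blinfun_apply \<eta> w)"

text \<open>
  In both problems the unknown is a family in \<open>Vh\<close> indexed by \<open>{1..N}\<close>, an extensional function so
  that uniqueness is meaningful. Both subdifferentials are taken on the full spaces. The set \<open>W\<close> is
  the space of test elements. Taking \<open>W = UNIV\<close> would overdetermine an unknown in \<open>Vh\<close>: with
  \<open>Vh = {0}\<close>, \<open>B = 0\<close>, \<open>J = 0\<close> and \<open>f \<noteq> 0\<close> there is then no solution. The Galerkin choice is
  \<open>W = Vh\<close>.
\<close>

definition incl_solution ::
  "'v::real_normed_vector set \<Rightarrow> ('v \<Rightarrow> 'v \<Rightarrow>\<^sub>L real) \<Rightarrow> ('v \<Rightarrow> 'v \<Rightarrow>\<^sub>L real) \<Rightarrow>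
   ('x::real_normed_vector \<Rightarrow> 'x \<Rightarrow> real) \<Rightarrow> ('v \<Rightarrow>\<^sub>L 'x) \<Rightarrow> (real \<Rightarrow> 'v \<Rightarrow>\<^sub>L real) \<Rightarrow> real \<Rightarrow>
   'v set \<Rightarrow> 'v \<Rightarrow> nat \<Rightarrow> (nat \<Rightarrow> 'v) \<Rightarrow> bool" where
  "incl_solution W A B J \<gamma> f T Vh u0h N v \<longleftrightarrow>
    v \<in> {1..N} \<rightarrow>\<^sub>E Vh \<and>
    (let k = T / real N in
     \<forall>j\<in>{1..N}. let u = discrete_K k u0h v (j - 1) in
       \<exists>\<zeta> \<in> clarke_subdiff (J (blinfun_apply \<gamma> u)) (blinfun_apply \<gamma> (v j)).
         eq_on_test W (A (v j) + B u + (\<zeta> o\<^sub>L \<gamma>)) (f (real j * k)))"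

definition opt_solution ::
  "'v::real_normed_vector set \<Rightarrow> ('v \<Rightarrow> 'v \<Rightarrow>\<^sub>L real) \<Rightarrow> ('v \<Rightarrow> 'v \<Rightarrow>\<^sub>L real) \<Rightarrow>
   ('x::real_normed_vector \<Rightarrow> 'x \<Rightarrow> real) \<Rightarrow> ('v \<Rightarrow>\<^sub>L 'x) \<Rightarrow> (real \<Rightarrow> 'v \<Rightarrow>\<^sub>L real) \<Rightarrow> real \<Rightarrow>
   'v set \<Rightarrow> 'v \<Rightarrow> nat \<Rightarrow> (nat \<Rightarrow> 'v) \<Rightarrow> bool" where
  "opt_solution W A B J \<gamma> f T Vh u0h N v \<longleftrightarrow>
    v \<in> {1..N} \<rightarrow>\<^sub>E Vh \<and>
    (let k = T / real N in
     \<forall>j\<in>{1..N}. let u = discrete_K k u0h v (j - 1) in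
       \<exists>\<xi> \<in> clarke_subdiff (step_functional A B J \<gamma> (f (real j * k)) u) (v j).
         eq_on_test W 0 \<xi>)"

text \<open>For \<open>W = UNIV\<close> the problems are literally the inclusions in the dual of the whole space.\<close>

lemma eq_on_test_UNIV: "eq_on_test UNIV \<xi> \<eta> \<longleftrightarrow> \<xi> = \<eta>"
  by (auto simp: eq_on_test_def intro: blinfun_eqI)

lemma incl_solution_UNIV:
  "incl_solution UNIV A B J \<gamma> f T Vh u0h N v \<longleftrightarrow>
    v \<in> {1..N} \<rightarrow>\<^sub>E Vh \<and>
    (\<forall>j\<in>{1..N}. \<exists>\<zeta> \<in> clarke_subdiff
        (J (blinfun_apply \<gamma> (discrete_K (T / real N) u0h v (j - 1)))) (blinfun_apply \<gamma> (v j)).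
       A (v j) + B (discrete_K (T / real N) u0h v (j - 1)) + (\<zeta> o\<^sub>L \<gamma>) = f (real j * (T / real N)))"
  by (simp add: incl_solution_def eq_on_test_UNIV Let_def)

lemma opt_solution_UNIV:
  "opt_solution UNIV A B J \<gamma> f T Vh u0h N v \<longleftrightarrow>
    v \<in> {1..N} \<rightarrow>\<^sub>E Vh \<and>
    (\<forall>j\<in>{1..N}. 0 \<in> clarke_subdiff
       (step_functional A B J \<gamma> (f (real j * (T / real N))) (discrete_K (T / real N) u0h v (j - 1)))
       (v j))"
  by (simp add: opt_solution_def eq_on_test_UNIV Let_def)

end

theory Submission
  imports Defs
begin

text \<open>
  At a single time step the state \<open>u\<close> is known, so the unknown velocity solves an elliptic problem
  for \<open>j = J (\<gamma> u)\<close> and the fixed functional \<open>b = B u - f\<^sub>j\<close>. The relaxed monotonicity of the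
  generalized derivative, integrated along segments, says that every Clarke subgradient \<open>\<zeta>\<close> of \<open>j\<close> at
  \<open>x\<close> supports \<open>j\<close> globally up to a quadratic error,
  \<open>j y \<ge> j x + \<zeta> (y - x) - m/2 \<parallel>y - x\<parallel>\<^sup>2\<close> (\<open>relaxed_monotone_lower_bound\<close>). The smallness condition
  lets the coercive form of \<open>A\<close> absorb this error, so the energy
  \<open>\<onehalf> A w w + b w + j (\<gamma> w)\<close> is strongly convex in the sense of subgradients (\<open>energy_growth\<close>).

  Everything about one step follows from this estimate and the Hahn-Banach theorem. A functional
  \<open>A v + b + \<zeta> \<circ> \<gamma>\<close> with \<open>\<zeta>\<close> in the subdifferential of \<open>j\<close> at \<open>\<gamma> v\<close> supports the energy globally from
  below, hence is a Clarke subgradient of it; conversely the generalized derivative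
  of the energy is dominated by that of \<open>j\<close> along \<open>\<gamma>\<close>, and extending the resulting functional from
  the range of \<open>\<gamma>\<close> gives \<open>\<zeta>\<close>. So the subdifferential of the energy is exactly the set of left-hand
  sides of the inclusion minus the load (\<open>energy_subdiff\<close>), which makes the two problems equivalent step by step and for
  every space of test elements.

  For the Galerkin problem, strong convexity gives a minimizer over the closed subspace \<open>Vh\<close>, and
  the same extension argument, now starting from \<open>Vh\<close>, turns minimality into the inclusion tested
  with \<open>Vh\<close> (\<open>galerkin_exists\<close>). Strong monotonicity gives uniqueness, and testing with the solution
  bounds its norm by data that are affine in the norm of the state (\<open>galerkin_norm_bound\<close>). As the state
  depends only on earlier velocities, unique solvability passes to the whole scheme by
  recursion. A discrete Gronwall inequality makes the bound uniform: its constant involves \<open>k N = T\<close>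
  but neither \<open>N\<close> nor \<open>Vh\<close>, and the loads are bounded on the compact time interval.
\<close>

section \<open>Sublinear functionals and the Hahn-Banach theorem\<close>

text \<open>
  Homogeneity is only required as an inequality for positive factors; applied to a factor and its
  inverse this gives the equality, and it also forces the value zero at the origin.
\<close>

definition sublinear :: "('a::real_vector \<Rightarrow> real) \<Rightarrow> bool" where
  "sublinear p \<longleftrightarrow> (\<forall>x y. p (x + y) \<le> p x + p y) \<and> (\<forall>s>0. \<forall>x. p (s *\<^sub>R x) \<le> s * p x)"

lemma sublinear_add: "sublinear p \<Longrightarrow> p (x + y) \<le> p x + p y"
  by (simp add: sublinear_def)

lemma sublinear_zero:
  assumes "sublinear p" shows "p 0 = 0"
proof -
  have "p (2 *\<^sub>R 0) \<le> 2 * p 0" "p ((1/2) *\<^sub>R 0) \<le> (1/2) * p 0"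
    using assms unfolding sublinear_def by (meson zero_less_numeral half_gt_zero zero_less_one)+
  then show ?thesis by simp
qed

lemma sublinear_scale:
  assumes "sublinear p" "s \<ge> 0" shows "p (s *\<^sub>R x) = s * p x"
proof (cases "s = 0")
  case True then show ?thesis using assms sublinear_zero by simp
next
  case False
  with assms have s: "s > 0" by simp
  then have "p (inverse s *\<^sub>R (s *\<^sub>R x)) \<le> inverse s * p (s *\<^sub>R x)" "p (s *\<^sub>R x) \<le> s * p x"
    using assms unfolding sublinear_def by (metis inverse_positive_iff_positive)+
  then show ?thesis using s by (simp add: field_simps)
qed

lemma sublinear_ge_neg: "sublinear p \<Longrightarrow> - p (- x) \<le> p x"
  using sublinear_add[of p x "- x"] sublinear_zero[of p] by simp

text \<open>
  The functional \<open>q\<close> is the infimal convolution of \<open>p\<close> with the constraints in \<open>K\<close>, where a pair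
  \<open>(k, r)\<close> encodes the demand \<open>q k \<le> r\<close>. Because \<open>K\<close> is a convex cone, \<open>q\<close> is again sublinear;
  because no single demand contradicts \<open>p\<close>, the infimum is finite.
\<close>

lemma sublinear_minorant_on_cone:
  assumes p: "sublinear p"
    and zero: "(0, 0) \<in> K"
    and add: "\<And>k r k' r'. (k, r) \<in> K \<Longrightarrow> (k', r') \<in> K \<Longrightarrow> (k + k', r + r') \<in> K"
    and scale: "\<And>s k r. s > 0 \<Longrightarrow> (k, r) \<in> K \<Longrightarrow> (s *\<^sub>R k, s * r) \<in> K"
    and compat: "\<And>k r. (k, r) \<in> K \<Longrightarrow> - p (- k) \<le> r"
  obtains q where "sublinear q" "\<And>x. q x \<le> p x" "\<And>k r. (k, r) \<in> K \<Longrightarrow> q k \<le> r"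
proof -
  define q where "q x = (INF (k, r)\<in>K. p (x - k) + r)" for x
  have bdd: "bdd_below ((\<lambda>(k, r). p (x - k) + r) ` K)" for x
  proof (rule bdd_belowI)
    fix y assume "y \<in> (\<lambda>(k, r). p (x - k) + r) ` K"
    then obtain k r where y: "y = p (x - k) + r" and "(k, r) \<in> K" by auto
    have "p (- k) \<le> p (x - k) + p (- x)"
      using sublinear_add[OF p, of "x - k" "- x"] by simp
    then show "- p (- x) \<le> y" using compat[OF \<open>(k, r) \<in> K\<close>] y by simp
  qed
  have le: "q x \<le> p (x - k) + r" if "(k, r) \<in> K" for x k r
    unfolding q_def using cINF_lower[OF bdd that] by simp
  have ge: "c \<le> q x" if "\<And>k r. (k, r) \<in> K \<Longrightarrow> c \<le> p (x - k) + r" for c x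
    unfolding q_def by (rule cINF_greatest) (use zero that in auto)
  have q_add: "q (x + y) \<le> q x + q y" for x y
  proof -
    have "q (x + y) - (p (y - k') + r') \<le> q x" if 1: "(k', r') \<in> K" for k' r'
    proof (rule ge)
      fix k r assume 2: "(k, r) \<in> K"
      have "q (x + y) \<le> p ((x - k) + (y - k')) + (r + r')"
        using le[OF add[OF 2 1], of "x + y"] by (simp add: algebra_simps)
      then show "q (x + y) - (p (y - k') + r') \<le> p (x - k) + r"
        using sublinear_add[OF p, of "x - k" "y - k'"] by simp
    qed
    then have "q (x + y) - q x \<le> q y" by (intro ge) (simp add: algebra_simps)
    then show ?thesis by simp
  qed
  have q_scale: "q (s *\<^sub>R x) \<le> s * q x" if "s > 0" for s x
  proof -
    have "q (s *\<^sub>R x) / s \<le> q x"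
    proof (rule ge)
      fix k r assume 1: "(k, r) \<in> K"
      have "q (s *\<^sub>R x) \<le> p (s *\<^sub>R (x - k)) + s * r"
        using le[OF scale[OF that 1], of "s *\<^sub>R x"] by (simp add: scaleR_right_diff_distrib)
      also have "\<dots> = s * (p (x - k) + r)"
        using sublinear_scale[OF p, of s "x - k"] that by (simp add: distrib_left)
      finally show "q (s *\<^sub>R x) / s \<le> p (x - k) + r"
        using that by (simp add: pos_divide_le_eq mult.commute)
    qed
    then show ?thesis using that by (simp add: field_simps)
  qed
  show ?thesis
  proof
    show "sublinear q" using q_add q_scale by (simp add: sublinear_def)
    show "q x \<le> p x" for x using le[OF zero, of x] by simp
    show "q k \<le> r" if "(k, r) \<in> K" for k r
      using le[OF that, of k] sublinear_zero[OF p] by simp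
  qed
qed

text \<open>
  The infimum of a chain is the required lower bound: it is finite because all functionals below
  \<open>p\<close> are bounded below by \<open>- p (- x)\<close>, and subadditive because two members of a chain can be
  replaced by the smaller one.
\<close>

lemma minimal_sublinear_exists:
  assumes p: "sublinear p"
  obtains q where "sublinear q" "\<And>x. q x \<le> p x"
    "\<And>g. sublinear g \<Longrightarrow> (\<And>x. g x \<le> q x) \<Longrightarrow> g = q"
proof -
  define S where "S = {q. sublinear q \<and> q \<le> p}"
  define P :: "('a \<Rightarrow> real) \<Rightarrow> ('a \<Rightarrow> real) \<Rightarrow> bool" where "P = (\<lambda>f g. g \<le> f)"
  have "\<exists>m\<in>S. \<forall>a\<in>S. P m a \<longrightarrow> a = m"
  proof (rule predicate_Zorn)
    show "partial_order_on S (relation_of P S)"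
      by (rule partial_order_on_relation_ofI) (auto simp: P_def)
    fix C assume C: "C \<in> Chains (relation_of P S)"
    then have CS: "C \<subseteq> S" by (auto simp: Chains_def relation_of_def)
    have total: "f \<le> g \<or> g \<le> f" if "f \<in> C" "g \<in> C" for f g
      using C that by (auto simp: Chains_def relation_of_def P_def)
    show "\<exists>u\<in>S. \<forall>a\<in>C. P a u"
    proof (cases "C = {}")
      case True
      then show ?thesis using p by (auto simp: S_def)
    next
      case False
      define q where "q x = (INF f\<in>C. f x)" for x
      have bdd: "bdd_below ((\<lambda>f. f x) ` C)" for x
      proof (rule bdd_belowI)
        fix y assume "y \<in> (\<lambda>f. f x) ` C"
        then obtain f where f: "f \<in> C" "y = f x" by auto
        then have "sublinear f" "f (- x) \<le> p (- x)" using CS by (auto simp: S_def le_fun_def)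
        then show "- p (- x) \<le> y" using sublinear_ge_neg[of f x] f by simp
      qed
      have le: "q x \<le> f x" if "f \<in> C" for f x
        unfolding q_def using that by (rule cINF_lower[OF bdd])
      have ge: "c \<le> q x" if "\<And>f. f \<in> C \<Longrightarrow> c \<le> f x" for c x
        unfolding q_def by (rule cINF_greatest) (use False that in auto)
      have "q (x + y) \<le> q x + q y" for x y
      proof -
        have "q (x + y) - g y \<le> q x" if g: "g \<in> C" for g
        proof (rule ge)
          fix f assume f: "f \<in> C"
          obtain h where h: "h \<in> C" "h \<le> f" "h \<le> g" using total[OF f g] f g by blast
          have "q (x + y) \<le> h x + h y"
            using le[OF h(1), of "x + y"] sublinear_add[of h x y] h(1) CS by (auto simp: S_def)
          then show "q (x + y) - g y \<le> f x" using h(2,3) by (simp add: le_fun_def) (smt (verit))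
        qed
        then have "q (x + y) - q x \<le> q y" by (intro ge) (simp add: algebra_simps)
        then show ?thesis by simp
      qed
      moreover have "q (s *\<^sub>R x) \<le> s * q x" if s: "s > 0" for s x
      proof -
        have "q (s *\<^sub>R x) / s \<le> q x"
        proof (rule ge)
          fix f assume f: "f \<in> C"
          then have "f (s *\<^sub>R x) = s * f x"
            using CS sublinear_scale[of f s x] s by (auto simp: S_def)
          then show "q (s *\<^sub>R x) / s \<le> f x" using le[OF f, of "s *\<^sub>R x"] s by (simp add: field_simps)
        qed
        then show ?thesis using s by (simp add: field_simps)
      qed
      moreover have "q \<le> p"
      proof (rule le_funI)
        fix x
        obtain f where "f \<in> C" using False by blast
        then show "q x \<le> p x" using le[of f x] CS by (auto simp: S_def le_fun_def intro: order_trans)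
      qed
      ultimately have "q \<in> S" by (simp add: S_def sublinear_def)
      moreover have "\<forall>a\<in>C. P a q" using le by (auto simp: P_def le_fun_def)
      ultimately show ?thesis by blast
    qed
  qed
  then obtain q where q: "q \<in> S" and min: "\<And>g. g \<in> S \<Longrightarrow> g \<le> q \<Longrightarrow> g = q"
    by (auto simp: P_def)
  show ?thesis
  proof
    show "sublinear q" "\<And>x. q x \<le> p x" using q by (auto simp: S_def le_fun_def)
    show "g = q" if "sublinear g" "\<And>x. g x \<le> q x" for g
      using min[of g] that q by (auto simp: S_def le_fun_def intro: order_trans)
  qed
qed

text \<open>
  A minimal sublinear functional \<open>q\<close> is linear: the demand \<open>q (- a) \<le> - q a\<close> along a ray is
  consistent with \<open>q\<close>, so by minimality \<open>q\<close> already satisfies it, and then subadditivity is an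
  equality. Linear functionals below \<open>p\<close> that respect \<open>K\<close> are thus found below the minorant
  belonging to \<open>K\<close>.
\<close>

lemma Hahn_Banach_on_cone:
  assumes p: "sublinear p"
    and zero: "(0, 0) \<in> K"
    and add: "\<And>k r k' r'. (k, r) \<in> K \<Longrightarrow> (k', r') \<in> K \<Longrightarrow> (k + k', r + r') \<in> K"
    and scale: "\<And>s k r. s > 0 \<Longrightarrow> (k, r) \<in> K \<Longrightarrow> (s *\<^sub>R k, s * r) \<in> K"
    and compat: "\<And>k r. (k, r) \<in> K \<Longrightarrow> - p (- k) \<le> r"
  obtains g :: "'a::real_vector \<Rightarrow> real"
  where "linear g" "\<And>x. g x \<le> p x" "\<And>k r. (k, r) \<in> K \<Longrightarrow> g k \<le> r"
proof -
  obtain p' where p': "sublinear p'" "\<And>x. p' x \<le> p x" "\<And>k r. (k, r) \<in> K \<Longrightarrow> p' k \<le> r"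
    using sublinear_minorant_on_cone[OF assms] by blast
  obtain q where q: "sublinear q" "\<And>x. q x \<le> p' x"
    and min: "\<And>g. sublinear g \<Longrightarrow> (\<And>x. g x \<le> q x) \<Longrightarrow> g = q"
    using minimal_sublinear_exists[OF p'(1)] by blast
  have neg: "q (- a) \<le> - q a" for a
  proof -
    define R where "R = {(t *\<^sub>R (- a), - (t * q a)) | t. t \<ge> (0::real)}"
    have R_zero: "(0, 0) \<in> R"
      unfolding R_def by (rule CollectI, rule exI[of _ 0]) simp
    have R_add: "(k + k', r + r') \<in> R" if kr: "(k, r) \<in> R" "(k', r') \<in> R" for k r k' r'
    proof -
      obtain t t' where t: "t \<ge> 0" "k = t *\<^sub>R (- a)" "r = - (t * q a)"
        "t' \<ge> 0" "k' = t' *\<^sub>R (- a)" "r' = - (t' * q a)"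
        using kr unfolding R_def by auto
      show ?thesis unfolding R_def
        by (rule CollectI, rule exI[of _ "t + t'"]) (use t in \<open>auto simp: algebra_simps\<close>)
    qed
    have R_scale: "(s *\<^sub>R k, s * r) \<in> R" if s: "s > 0" and kr: "(k, r) \<in> R" for s k r
    proof -
      obtain t where t: "t \<ge> 0" "k = t *\<^sub>R (- a)" "r = - (t * q a)"
        using kr unfolding R_def by auto
      show ?thesis unfolding R_def
        by (rule CollectI, rule exI[of _ "s * t"]) (use t s in auto)
    qed
    have R_compat: "- q (- k) \<le> r" if "(k, r) \<in> R" for k r
      using that sublinear_scale[OF q(1)] by (auto simp: R_def)
    obtain g where g: "sublinear g" "\<And>x. g x \<le> q x" "\<And>k r. (k, r) \<in> R \<Longrightarrow> g k \<le> r"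
      using sublinear_minorant_on_cone[OF q(1) R_zero R_add R_scale R_compat] by blast
    have "(- a, - q a) \<in> R" unfolding R_def by (rule CollectI, rule exI[of _ 1]) simp
    then show ?thesis using g min[of g] by metis
  qed
  have additive: "q (x + y) = q x + q y" for x y
    using sublinear_add[OF q(1), of x y] sublinear_add[OF q(1), of "x + y" "- y"] neg[of y] by simp
  have odd: "q (- x) = - q x" for x
    using additive[of x "- x"] sublinear_zero[OF q(1)] by simp
  have "q (s *\<^sub>R x) = s * q x" for s x
  proof (cases "s \<ge> 0")
    case False
    then show ?thesis using sublinear_scale[OF q(1), of "- s" "x"] odd[of "s *\<^sub>R x"] by simp
  qed (use sublinear_scale[OF q(1)] in simp)
  then have "linear q" using additive by (simp add: linearI)
  then show ?thesis using that[of q] q(2) p'(2,3) by (meson order_trans)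
qed

section \<open>Generalized directional derivatives and subgradients\<close>

lemma eventually_snd_pos: "\<forall>\<^sub>F z in nhds x \<times>\<^sub>F at_right (0::real). 0 < snd z"
proof -
  have "filterlim snd (at_right (0::real)) (nhds x \<times>\<^sub>F at_right 0)" by (rule filterlim_snd)
  then show ?thesis
    using eventually_at_right_less[of "0::real"] unfolding filterlim_iff by blast
qed

text \<open>
  Clearing the denominator turns the extended-real limes superior into a real inequality between
  increments, in which form the bounds below can be added and multiplied.
\<close>

lemma clarke_deriv_le_iff:
  "clarke_deriv j x v \<le> ereal c \<longleftrightarrow>
    (\<forall>e>0. \<forall>\<^sub>F (y, t) in nhds x \<times>\<^sub>F at_right 0. j (y + t *\<^sub>R v) - j y \<le> (c + e) * t)"
  (is "?L \<longleftrightarrow> ?R")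
proof -
  note pos = eventually_snd_pos[of x]
  show ?thesis
  proof
    assume L: ?L
    show ?R
    proof (intro allI impI)
      fix e :: real assume "e > 0"
      then have "\<forall>\<^sub>F z in nhds x \<times>\<^sub>F at_right 0.
          (case z of (y, t) \<Rightarrow> ereal ((j (y + t *\<^sub>R v) - j y) / t)) < ereal (c + e)"
        using L unfolding clarke_deriv_def Limsup_le_iff by simp
      with pos show "\<forall>\<^sub>F (y, t) in nhds x \<times>\<^sub>F at_right 0. j (y + t *\<^sub>R v) - j y \<le> (c + e) * t"
        by eventually_elim (auto simp: field_simps split: prod.splits)
    qed
  next
    assume R: ?R
    show ?L
      unfolding clarke_deriv_def Limsup_le_iff
    proof (intro allI impI)
      fix b assume "ereal c < b"
      then obtain d where d: "c < d" "ereal d < b"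
        using ereal_dense2 by force
      then have "\<forall>\<^sub>F (y, t) in nhds x \<times>\<^sub>F at_right 0. j (y + t *\<^sub>R v) - j y \<le> d * t"
        using R[rule_format, of "d - c"] by simp
      with pos show "\<forall>\<^sub>F z in nhds x \<times>\<^sub>F at_right 0.
          (case z of (y, t) \<Rightarrow> ereal ((j (y + t *\<^sub>R v) - j y) / t)) < b"
      proof eventually_elim
        case (elim z)
        obtain y t where z: "z = (y, t)" by (cases z)
        then have "(j (y + t *\<^sub>R v) - j y) / t \<le> d" using elim by (simp add: field_simps)
        then show ?case using d z by (simp add: le_less_trans[of _ "ereal d"])
      qed
    qed
  qed
qed

text \<open>
  Since \<open>nhds x\<close>, unlike \<open>at x\<close>, retains \<open>x\<close>, the ordinary one-sided difference quotients at \<open>x\<close>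
  compete in the limes superior.
\<close>

lemma eventually_base_point:
  assumes "\<forall>\<^sub>F (y, t) in nhds x \<times>\<^sub>F at_right 0. P y t"
  shows "\<forall>\<^sub>F t in at_right 0. P x t"
proof -
  have "filterlim (\<lambda>t. (x, t)) (nhds x \<times>\<^sub>F at_right 0) (at_right 0)"
    by (intro filterlim_Pair tendsto_const filterlim_ident)
  from filterlim_iff[THEN iffD1, OF this] assms show ?thesis by fastforce
qed

lemma clarke_deriv_ge:
  assumes "\<forall>\<^sub>F t in at_right 0. a * t \<le> j (x + t *\<^sub>R v) - j x"
  shows "ereal a \<le> clarke_deriv j x v"
proof (rule ereal_le_real)
  fix c assume c: "clarke_deriv j x v \<le> ereal c"
  have "a \<le> c + e" if "e > 0" for e
  proof -
    have "\<forall>\<^sub>F t in at_right 0. j (x + t *\<^sub>R v) - j x \<le> (c + e) * t"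
      using c that eventually_base_point unfolding clarke_deriv_le_iff by blast
    with assms eventually_at_right_less[of "0::real"]
    have "\<forall>\<^sub>F t::real in at_right 0. a \<le> c + e"
    proof eventually_elim
      case (elim t)
      then have "a * t \<le> (c + e) * t" by linarith
      with elim show ?case by simp
    qed
    then show ?thesis by simp
  qed
  then show "ereal a \<le> ereal c" using field_le_epsilon by auto
qed

lemma tendsto_shifted_base_point:
  fixes x v :: "'a::real_normed_vector"
  shows "((\<lambda>(y, t::real). y + t *\<^sub>R v) \<longlongrightarrow> x) (nhds x \<times>\<^sub>F at_right 0)"
proof -
  have 1: "filterlim fst (nhds x) (nhds x \<times>\<^sub>F at_right (0::real))" by (rule filterlim_fst)
  have "filterlim snd (at_right (0::real)) (nhds x \<times>\<^sub>F at_right 0)" by (rule filterlim_snd)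
  then have 2: "(snd \<longlongrightarrow> (0::real)) (nhds x \<times>\<^sub>F at_right 0)"
    unfolding filterlim_at by blast
  have "((\<lambda>z. fst z + snd z *\<^sub>R v) \<longlongrightarrow> x + 0 *\<^sub>R v) (nhds x \<times>\<^sub>F at_right (0::real))"
    by (intro tendsto_intros 1 2)
  then show ?thesis by (simp add: case_prod_beta')
qed

lemma locally_lipschitz_increment:
  assumes "locally_lipschitz (j :: 'a::real_normed_vector \<Rightarrow> real)"
  obtains L where "L \<ge> 0"
    "\<And>v. \<forall>\<^sub>F (y, t) in nhds x \<times>\<^sub>F at_right 0. \<bar>j (y + t *\<^sub>R v) - j y\<bar> \<le> L * norm v * t"
proof -
  obtain U L where U: "open U" "x \<in> U" and L: "L-lipschitz_on U j"
    using assms unfolding locally_lipschitz_def by blast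
  have "\<forall>\<^sub>F (y, t) in nhds x \<times>\<^sub>F at_right 0. \<bar>j (y + t *\<^sub>R v) - j y\<bar> \<le> L * norm v * t" for v
  proof -
    have "\<forall>\<^sub>F z in nhds x \<times>\<^sub>F at_right (0::real). fst z \<in> U"
      using filterlim_fst[of "nhds x" "at_right (0::real)"] U topological_tendstoD by blast
    moreover have "\<forall>\<^sub>F z in nhds x \<times>\<^sub>F at_right (0::real). (case z of (y, t) \<Rightarrow> y + t *\<^sub>R v) \<in> U"
      using tendsto_shifted_base_point U topological_tendstoD by blast
    moreover have "\<forall>\<^sub>F z in nhds x \<times>\<^sub>F at_right (0::real). 0 < snd z"
      by (rule eventually_snd_pos)
    ultimately show ?thesis
    proof eventually_elim
      case (elim z)
      obtain y t where z: "z = (y, t)" by (cases z)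
      then have "dist (j (y + t *\<^sub>R v)) (j y) \<le> L * dist (y + t *\<^sub>R v) y"
        using lipschitz_onD[OF L] elim by simp
      then show ?case using elim z by (simp add: dist_norm algebra_simps)
    qed
  qed
  then show ?thesis using that lipschitz_on_nonneg[OF L] by blast
qed

lemma locally_lipschitz_continuous:
  assumes "locally_lipschitz (j :: 'a::metric_space \<Rightarrow> real)"
  shows "continuous_on UNIV j"
proof (rule continuous_at_imp_continuous_on, rule ballI)
  fix x
  obtain U L where "open U" "x \<in> U" "L-lipschitz_on U j"
    using assms unfolding locally_lipschitz_def by blast
  then show "isCont j x"
    using lipschitz_on_continuous_on continuous_on_eq_continuous_at by blast
qed

text \<open>
  The derivative is finite for locally Lipschitz \<open>j\<close>; an infinite value would be mapped to the
  default \<open>0\<close>.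
\<close>

definition clarke_real :: "('a::real_normed_vector \<Rightarrow> real) \<Rightarrow> 'a \<Rightarrow> 'a \<Rightarrow> real" where
  "clarke_real j x v = real_of_ereal (clarke_deriv j x v)"

lemma clarke_real_bound:
  assumes "locally_lipschitz j"
  obtains L where "L \<ge> 0" "\<And>v. clarke_deriv j x v = ereal (clarke_real j x v)"
    "\<And>v. clarke_real j x v \<le> L * norm v"
proof -
  obtain L where L: "L \<ge> 0"
    "\<And>v. \<forall>\<^sub>F (y, t) in nhds x \<times>\<^sub>F at_right 0. \<bar>j (y + t *\<^sub>R v) - j y\<bar> \<le> L * norm v * t"
    using locally_lipschitz_increment[OF assms] by blast
  have up: "clarke_deriv j x v \<le> ereal (L * norm v)" for v
    unfolding clarke_deriv_le_iff
  proof (intro allI impI)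
    fix e :: real assume e: "e > 0"
    have "\<forall>\<^sub>F z in nhds x \<times>\<^sub>F at_right (0::real). 0 < snd z"
      by (rule eventually_snd_pos)
    with L(2)[of v] show "\<forall>\<^sub>F (y, t) in nhds x \<times>\<^sub>F at_right 0. j (y + t *\<^sub>R v) - j y \<le> (L * norm v + e) * t"
    proof eventually_elim
      case (elim z)
      obtain y t where z: "z = (y, t)" by (cases z)
      then have "e * t \<ge> 0" using elim e by simp
      then show ?case using elim z by (simp add: distrib_right)
    qed
  qed
  have low: "ereal (- (L * norm v)) \<le> clarke_deriv j x v" for v
  proof (rule clarke_deriv_ge)
    have "\<forall>\<^sub>F t in at_right 0. \<bar>j (x + t *\<^sub>R v) - j x\<bar> \<le> L * norm v * t"
      by (rule eventually_base_point) (rule L(2))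
    then show "\<forall>\<^sub>F t in at_right 0. - (L * norm v) * t \<le> j (x + t *\<^sub>R v) - j x"
      by eventually_elim auto
  qed
  have eq: "clarke_deriv j x v = ereal (clarke_real j x v)" for v
    using up[of v] low[of v] unfolding clarke_real_def by (cases "clarke_deriv j x v") auto
  show ?thesis
    using that[of L] L(1) eq up by (metis ereal_less_eq(3))
qed

lemma clarke_deriv_eq_real: "locally_lipschitz j \<Longrightarrow> clarke_deriv j x v = ereal (clarke_real j x v)"
  using clarke_real_bound by blast

lemma clarke_real_increment:
  assumes "locally_lipschitz j" "e > 0"
  shows "\<forall>\<^sub>F (y, t) in nhds x \<times>\<^sub>F at_right 0. j (y + t *\<^sub>R v) - j y \<le> (clarke_real j x v + e) * t"
  using clarke_deriv_le_iff[of j x v "clarke_real j x v"] clarke_deriv_eq_real[OF assms(1)] assms(2)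
  by simp

text \<open>
  Subadditivity comes from splitting an increment in direction \<open>u + v\<close> at the intermediate point
  \<open>y + t u\<close>; this point also tends to \<open>x\<close>, which is why the base point has to vary in the
  definition of the generalized derivative.
\<close>

lemma sublinear_clarke_real:
  assumes j: "locally_lipschitz j"
  shows "sublinear (clarke_real j x)"
proof -
  have "clarke_deriv j x (u + v) \<le> ereal (clarke_real j x u + clarke_real j x v)" for u v
    unfolding clarke_deriv_le_iff
  proof (intro allI impI)
    fix e :: real assume e: "e > 0"
    have u: "\<forall>\<^sub>F (y, t) in nhds x \<times>\<^sub>F at_right 0. j (y + t *\<^sub>R u) - j y \<le> (clarke_real j x u + e/2) * t"
      using clarke_real_increment[OF j] e by simp
    have v: "\<forall>\<^sub>F (y, t) in nhds x \<times>\<^sub>F at_right 0. j (y + t *\<^sub>R v) - j y \<le> (clarke_real j x v + e/2) * t"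
      using clarke_real_increment[OF j] e by simp
    have "filterlim (\<lambda>z. ((\<lambda>(y, t). y + t *\<^sub>R u) z, snd z)) (nhds x \<times>\<^sub>F at_right 0) (nhds x \<times>\<^sub>F at_right (0::real))"
      by (intro filterlim_Pair tendsto_shifted_base_point filterlim_snd)
    with v have "\<forall>\<^sub>F z in nhds x \<times>\<^sub>F at_right (0::real).
        case ((\<lambda>(y, t). y + t *\<^sub>R u) z, snd z) of (y, t) \<Rightarrow> j (y + t *\<^sub>R v) - j y \<le> (clarke_real j x v + e/2) * t"
      unfolding filterlim_iff by blast
    with u show "\<forall>\<^sub>F (y, t) in nhds x \<times>\<^sub>F at_right 0.
        j (y + t *\<^sub>R (u + v)) - j y \<le> (clarke_real j x u + clarke_real j x v + e) * t"
      by eventually_elim (auto simp: algebra_simps)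
  qed
  then have add: "clarke_real j x (u + v) \<le> clarke_real j x u + clarke_real j x v" for u v
    using clarke_deriv_eq_real[OF j] by simp
  have "clarke_deriv j x (s *\<^sub>R v) \<le> ereal (s * clarke_real j x v)" if s: "s > 0" for s v
    unfolding clarke_deriv_le_iff
  proof (intro allI impI)
    fix e :: real assume e: "e > 0"
    have v: "\<forall>\<^sub>F (y, t) in nhds x \<times>\<^sub>F at_right 0. j (y + t *\<^sub>R v) - j y \<le> (clarke_real j x v + e/s) * t"
      using clarke_real_increment[OF j] e s by simp
    have "((\<lambda>t. s * t) \<longlongrightarrow> s * 0) (at_right (0::real))" by (intro tendsto_intros)
    then have "filterlim (\<lambda>t. s * t) (at_right 0) (at_right (0::real))"
      using s eventually_at_right_less[of "0::real"]
      by (auto simp: filterlim_at elim: eventually_mono)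
    then have "filterlim (\<lambda>z. s * snd z) (at_right 0) (nhds x \<times>\<^sub>F at_right (0::real))"
      using filterlim_snd filterlim_compose by blast
    then have "filterlim (\<lambda>z. (fst z, s * snd z)) (nhds x \<times>\<^sub>F at_right 0) (nhds x \<times>\<^sub>F at_right (0::real))"
      by (intro filterlim_Pair filterlim_fst)
    with v have "\<forall>\<^sub>F z in nhds x \<times>\<^sub>F at_right (0::real).
        case (fst z, s * snd z) of (y, t) \<Rightarrow> j (y + t *\<^sub>R v) - j y \<le> (clarke_real j x v + e/s) * t"
      unfolding filterlim_iff by blast
    then show "\<forall>\<^sub>F (y, t) in nhds x \<times>\<^sub>F at_right 0.
        j (y + t *\<^sub>R (s *\<^sub>R v)) - j y \<le> (s * clarke_real j x v + e) * t"
    proof eventually_elim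
      case (elim z)
      obtain y t where z: "z = (y, t)" by (cases z)
      have "(clarke_real j x v + e / s) * (s * t) = (s * clarke_real j x v + e) * t"
        using s by (simp add: field_simps)
      with elim show ?case by (simp only: z prod.case fst_conv snd_conv scaleR_scaleR mult.commute[of t s])
    qed
  qed
  then have "clarke_real j x (s *\<^sub>R v) \<le> s * clarke_real j x v" if "s > 0" for s v
    using clarke_deriv_eq_real[OF j] that by simp
  with add show ?thesis by (simp add: sublinear_def)
qed

lemma clarke_subdiff_iff:
  "locally_lipschitz j \<Longrightarrow> \<xi> \<in> clarke_subdiff j x \<longleftrightarrow> (\<forall>v. blinfun_apply \<xi> v \<le> clarke_real j x v)"
  by (simp add: clarke_subdiff_def clarke_deriv_eq_real)

text \<open>
  The Hahn-Banach theorem in the form needed for chain rules: a functional \<open>\<eta>\<close> that is dominated by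
  the generalized derivative along the image of a subspace under \<open>\<gamma>\<close> factors there through a
  subgradient. Continuity of the extension is automatic from the local Lipschitz bound.
\<close>

lemma clarke_subgradient_extends:
  fixes \<gamma> :: "'v::real_normed_vector \<Rightarrow>\<^sub>L 'x::real_normed_vector" and \<eta> :: "'v \<Rightarrow>\<^sub>L real"
  assumes j: "locally_lipschitz j" and S: "subspace S"
    and dom: "\<And>z. z \<in> S \<Longrightarrow> ereal (blinfun_apply \<eta> z) \<le> clarke_deriv j x (blinfun_apply \<gamma> z)"
  obtains \<zeta> where "\<zeta> \<in> clarke_subdiff j x"
    "\<And>z. z \<in> S \<Longrightarrow> blinfun_apply \<zeta> (blinfun_apply \<gamma> z) = blinfun_apply \<eta> z"
proof -
  obtain L where L: "\<And>v. clarke_real j x v \<le> L * norm v"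
    using clarke_real_bound[OF j] by metis
  define K where "K = (\<lambda>z. (blinfun_apply \<gamma> z, blinfun_apply \<eta> z)) ` S"
  have zero: "(0, 0) \<in> K"
    unfolding K_def by (rule image_eqI[of _ _ 0]) (use S in \<open>auto simp: blinfun.zero_right subspace_0\<close>)
  have add: "(k + k', r + r') \<in> K" if kr: "(k, r) \<in> K" "(k', r') \<in> K" for k r k' r'
  proof -
    obtain z z' where "z \<in> S" "k = \<gamma> z" "r = \<eta> z" "z' \<in> S" "k' = \<gamma> z'" "r' = \<eta> z'"
      using kr unfolding K_def by auto
    then show ?thesis unfolding K_def
      by (intro image_eqI[of _ _ "z + z'"]) (use S in \<open>auto simp: blinfun.add_right subspace_add\<close>)
  qed
  have scale: "(s *\<^sub>R k, s * r) \<in> K" if s: "s > 0" and kr: "(k, r) \<in> K" for s k r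
  proof -
    obtain z where "z \<in> S" "k = \<gamma> z" "r = \<eta> z"
      using kr unfolding K_def by auto
    then show ?thesis unfolding K_def
      by (intro image_eqI[of _ _ "s *\<^sub>R z"]) (use S in \<open>auto simp: blinfun.scaleR_right subspace_scale\<close>)
  qed
  have compat: "- clarke_real j x (- k) \<le> r" if kr: "(k, r) \<in> K" for k r
  proof -
    obtain z where z: "z \<in> S" "k = \<gamma> z" "r = \<eta> z"
      using kr unfolding K_def by auto
    have "\<eta> (- z) \<le> clarke_real j x (\<gamma> (- z))"
      using dom[of "- z"] clarke_deriv_eq_real[OF j] S z(1) by (simp add: subspace_neg)
    then show ?thesis using z by (simp add: blinfun.minus_right)
  qed
  obtain g where g: "linear g" "\<And>v. g v \<le> clarke_real j x v" "\<And>k r. (k, r) \<in> K \<Longrightarrow> g k \<le> r"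
    using Hahn_Banach_on_cone[OF sublinear_clarke_real[OF j] zero add scale compat] by blast
  have g_le: "g v \<le> L * norm v" for v using g(2) L order_trans by blast
  have bl: "bounded_linear g"
  proof (rule bounded_linear_intro[of _ L])
    show "g (a + b) = g a + g b" for a b using g(1) by (rule linear_add)
    show "g (c *\<^sub>R a) = c *\<^sub>R g a" for a c using g(1) by (rule linear_scale)
    show "norm (g a) \<le> norm a * L" for a
      using g_le[of a] g_le[of "- a"] linear_neg[OF g(1), of a] by (simp add: mult.commute)
  qed
  show ?thesis
  proof
    show "Blinfun g \<in> clarke_subdiff j x"
      using g(2) bl by (simp add: clarke_subdiff_iff[OF j] bounded_linear_Blinfun_apply)
    fix z assume z: "z \<in> S"
    have K: "(\<gamma> z, \<eta> z) \<in> K" "(\<gamma> (- z), \<eta> (- z)) \<in> K"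
      unfolding K_def using z S subspace_neg by auto
    have "g (\<gamma> (- z)) = - g (\<gamma> z)" using linear_neg[OF g(1)] by (simp add: blinfun.minus_right)
    with K[THEN g(3)] have "g (\<gamma> z) = \<eta> z" by (simp add: blinfun.minus_right)
    then show "Blinfun g (\<gamma> z) = \<eta> z" using bl by (simp add: bounded_linear_Blinfun_apply)
  qed
qed

lemma clarke_subdiff_nonempty:
  assumes "locally_lipschitz (j :: 'x::real_normed_vector \<Rightarrow> real)"
  obtains \<zeta> where "\<zeta> \<in> clarke_subdiff j x"
proof -
  have "clarke_real j x 0 = 0" using sublinear_zero sublinear_clarke_real[OF assms] by blast
  then have "ereal (blinfun_apply 0 z) \<le> clarke_deriv j x (blinfun_apply id_blinfun z)" if "z \<in> {0}" for z
    using that by (simp add: clarke_deriv_eq_real[OF assms] zero_ereal_def)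
  then show ?thesis
    using clarke_subgradient_extends[OF assms, of "{0}" 0 x id_blinfun] that by (metis subspace_single_0)
qed

lemma clarke_subdiffI:
  assumes "\<And>y. blinfun_apply \<xi> (y - x) \<le> j y - j x"
  shows "\<xi> \<in> clarke_subdiff j x"
  unfolding clarke_subdiff_def
proof (intro CollectI allI)
  fix v
  show "ereal (blinfun_apply \<xi> v) \<le> clarke_deriv j x v"
    by (intro clarke_deriv_ge always_eventually allI)
      (use assms[of "x + _ *\<^sub>R v"] in \<open>simp add: blinfun.scaleR_right mult.commute\<close>)
qed

section \<open>Relaxed monotonicity as a quadratic lower bound\<close>

text \<open>
  Adding a small multiple of the identity to \<open>h\<close> makes every point \<open>t > 0\<close> have a point to its left
  where the value is no larger. The leftmost point of the compact set of points whose value does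
  not exceed the value at \<open>1\<close> can then only be \<open>0\<close>.
\<close>

lemma le_of_left_dini:
  fixes h :: "real \<Rightarrow> real"
  assumes cont: "continuous_on {0..1} h"
    and dini: "\<And>t e. 0 < t \<Longrightarrow> t \<le> 1 \<Longrightarrow> e > 0 \<Longrightarrow> \<forall>\<^sub>F s in at_right 0. h (t - s) - h t \<le> e * s"
  shows "h 0 \<le> h 1"
proof (rule field_le_epsilon)
  fix e :: real assume e: "e > 0"
  define g where "g = (\<lambda>t. h t + e * t)"
  define S where "S = {0..1} \<inter> g -` {..g 1}"
  have "continuous_on {0..1} g" unfolding g_def by (intro continuous_intros cont)
  then have "closed S" unfolding S_def by (intro continuous_closed_preimage) auto
  moreover have "bounded S" unfolding S_def by (rule bounded_Int) simp
  ultimately have "compact S" by (simp add: compact_eq_bounded_closed)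
  moreover have "1 \<in> S" by (simp add: S_def)
  ultimately obtain t where t: "t \<in> S" "\<And>s. s \<in> S \<Longrightarrow> t \<le> s"
    using compact_attains_inf[of S] by blast
  have "t = 0"
  proof (rule ccontr)
    assume "t \<noteq> 0"
    then have t01: "0 < t" "t \<le> 1" using t(1) by (auto simp: S_def)
    have "\<forall>\<^sub>F s in at_right 0. 0 < s \<and> s < t"
      using eventually_at_right_real[OF t01(1)] by simp
    with dini[OF t01 e] have "\<forall>\<^sub>F s in at_right 0. t - s \<in> S \<and> 0 < s"
    proof eventually_elim
      case (elim s)
      then have "g (t - s) \<le> g t" by (simp add: g_def algebra_simps)
      then show ?case using t(1) t01 elim by (simp add: S_def)
    qed
    then obtain s where "t - s \<in> S" "0 < s"
      using eventually_happens' trivial_limit_at_right_real by blast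
    then show False using t(2) by fastforce
  qed
  then show "h 0 \<le> h 1 + e" using t(1) by (simp add: S_def g_def)
qed

text \<open>
  Along the segment \<open>x + t d\<close> the relaxed monotonicity condition compares the endpoint \<open>x\<close>, where
  \<open>\<zeta>\<close> bounds the derivative from below, with the point at parameter \<open>t\<close>: backward increments of
  \<open>j\<close> there have rate at most \<open>- \<zeta> d + t m \<parallel>d\<parallel>\<^sup>2\<close>. Integrating this over the segment, which the
  one-dimensional lemma does without differentiability, gives a semiconvexity estimate. The
  detour through segments replaces the Hilbert space argument that \<open>j\<close> plus a multiple of the
  squared norm is convex.
\<close>

lemma relaxed_monotone_lower_bound:
  assumes j: "locally_lipschitz (j :: 'x::real_normed_vector \<Rightarrow> real)"
    and relaxed: "\<And>v1 v2. clarke_deriv j v1 (v2 - v1) + clarke_deriv j v2 (v1 - v2)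
      \<le> ereal (m * (norm (v1 - v2))\<^sup>2)"
    and \<zeta>: "\<zeta> \<in> clarke_subdiff j x"
  shows "j x + blinfun_apply \<zeta> (y - x) - m / 2 * (norm (y - x))\<^sup>2 \<le> j y"
proof -
  define d where "d = y - x"
  define a where "a = blinfun_apply \<zeta> d"
  define M where "M = m * (norm d)\<^sup>2"
  define h where "h = (\<lambda>t. j (x + t *\<^sub>R d) - a * t + M / 2 * t\<^sup>2)"
  have rate: "clarke_real j (x + t *\<^sub>R d) (- d) \<le> - a + t * M" if t: "0 < t" for t
  proof -
    have "clarke_real j x (t *\<^sub>R d) + clarke_real j (x + t *\<^sub>R d) (t *\<^sub>R (- d)) \<le> m * (norm (t *\<^sub>R d))\<^sup>2"
      using relaxed[of x "x + t *\<^sub>R d"] by (simp add: clarke_deriv_eq_real[OF j])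
    moreover have "t * a \<le> clarke_real j x (t *\<^sub>R d)"
      using \<zeta> unfolding clarke_subdiff_iff[OF j] a_def by (metis blinfun.scaleR_right real_scaleR_def)
    moreover have "clarke_real j (x + t *\<^sub>R d) (t *\<^sub>R (- d)) = t * clarke_real j (x + t *\<^sub>R d) (- d)"
      using t by (intro sublinear_scale[OF sublinear_clarke_real[OF j]]) simp
    ultimately have "t * a + t * clarke_real j (x + t *\<^sub>R d) (- d) \<le> t * (t * M)"
      by (simp add: M_def power2_eq_square mult.assoc mult.left_commute)
    then have "t * (a + clarke_real j (x + t *\<^sub>R d) (- d)) \<le> t * (t * M)" by (simp add: distrib_left)
    then show ?thesis using t by simp
  qed
  have "h 0 \<le> h 1"
  proof (rule le_of_left_dini)
    have "continuous_on {0..1} (\<lambda>t. j (x + t *\<^sub>R d))"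
      by (rule continuous_on_compose2[OF locally_lipschitz_continuous[OF j]]) (auto intro!: continuous_intros)
    then show "continuous_on {0..1} h" unfolding h_def by (intro continuous_intros)
    fix t e :: real assume t: "0 < t" "t \<le> 1" and e: "e > 0"
    have inc: "\<forall>\<^sub>F s in at_right 0. j (x + t *\<^sub>R d + s *\<^sub>R (- d)) - j (x + t *\<^sub>R d)
        \<le> (clarke_real j (x + t *\<^sub>R d) (- d) + e / 2) * s"
      using e by (intro eventually_base_point clarke_real_increment[OF j]) simp
    have "((\<lambda>s. M * s) \<longlongrightarrow> M * 0) (at_right (0::real))" by (intro tendsto_intros)
    then have "\<forall>\<^sub>F s in at_right 0. M * s < e"
      using e by (simp add: order_tendstoD)
    with inc eventually_at_right_less[of "0::real"]
    show "\<forall>\<^sub>F s in at_right 0. h (t - s) - h t \<le> e * s"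
    proof eventually_elim
      case (elim s)
      have "j (x + (t - s) *\<^sub>R d) - j (x + t *\<^sub>R d) \<le> (clarke_real j (x + t *\<^sub>R d) (- d) + e / 2) * s"
        using elim(1) by (simp add: algebra_simps)
      also have "\<dots> \<le> (- a + t * M + e / 2) * s"
        using rate[OF t(1)] elim(2) by (intro mult_right_mono) auto
      finally have "h (t - s) - h t \<le> (M * s) * s / 2 + e / 2 * s"
        by (simp add: h_def power2_eq_square algebra_simps add_divide_distrib diff_divide_distrib)
      moreover have "(M * s) * s \<le> e * s" using elim by (intro mult_right_mono) auto
      ultimately show ?case by simp
    qed
  qed
  then show ?thesis by (simp add: h_def M_def a_def d_def)
qed

section \<open>Finite dimensional subspaces are closed\<close>

text \<open>
  In the inductive step the coefficient of the new vector depends continuously on the element, so it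
  converges along a convergent sequence, and the remaining part then converges in a closed span.
\<close>

lemma closed_span_finite:
  fixes E :: "'v::real_normed_vector set"
  assumes "finite E"
  shows "closed (span E)"
  using assms
proof induction
  case (insert a E)
  show ?case
  proof (cases "a \<in> span E")
    case True
    then show ?thesis using insert.IH by (simp add: span_redundant)
  next
    case False
    \<comment> \<open>The coefficient of \<open>a\<close> is controlled by the positive distance \<open>d\<close> from \<open>a\<close> to the span of \<open>E\<close>.\<close>
    define d where "d = infdist a (span E)"
    have d: "d > 0"
      unfolding d_def using infdist_pos_not_in_closed[OF insert.IH _ False] span_zero[of E] by force
    have coeff: "\<bar>t\<bar> * d \<le> norm (s + t *\<^sub>R a)" if s: "s \<in> span E" for s t
    proof (cases "t = 0")
      case False
      have "- (inverse t *\<^sub>R s) \<in> span E" by (intro span_neg span_scale s)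
      then have "d \<le> dist a (- (inverse t *\<^sub>R s))" unfolding d_def by (rule infdist_le)
      then have "\<bar>t\<bar> * d \<le> \<bar>t\<bar> * norm (a + inverse t *\<^sub>R s)" by (simp add: dist_norm mult_left_mono)
      also have "\<dots> = norm (t *\<^sub>R (a + inverse t *\<^sub>R s))" by simp
      also have "t *\<^sub>R (a + inverse t *\<^sub>R s) = s + t *\<^sub>R a" using False by (simp add: algebra_simps)
      finally show ?thesis .
    qed simp
    show ?thesis
      unfolding closed_sequential_limits
    proof (intro allI impI, elim conjE)
      fix x l assume x: "\<forall>n. x n \<in> span (insert a E)" and lim: "x \<longlonglongrightarrow> l"
      obtain t where t: "\<And>n. x n - t n *\<^sub>R a \<in> span E"
        using choice[OF x[unfolded span_breakdown_eq]] by blast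
      have "Cauchy t"
      proof (rule metric_CauchyI)
        fix e :: real assume e: "e > 0"
        obtain M where M: "\<And>m n. m \<ge> M \<Longrightarrow> n \<ge> M \<Longrightarrow> dist (x m) (x n) < e * d"
          using metric_CauchyD[OF LIMSEQ_imp_Cauchy[OF lim], of "e * d"] e d by auto
        have "dist (t m) (t n) < e" if mn: "m \<ge> M" "n \<ge> M" for m n
        proof -
          have "\<bar>t m - t n\<bar> * d \<le> norm (((x m - t m *\<^sub>R a) - (x n - t n *\<^sub>R a)) + (t m - t n) *\<^sub>R a)"
            by (intro coeff span_diff t)
          also have "\<dots> = dist (x m) (x n)" by (simp add: dist_norm scaleR_left_diff_distrib)
          also have "\<dots> < e * d" by (rule M[OF mn])
          finally show ?thesis using d by (simp add: dist_norm)
        qed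
        then show "\<exists>M. \<forall>m\<ge>M. \<forall>n\<ge>M. dist (t m) (t n) < e" by blast
      qed
      then obtain t0 where t0: "t \<longlonglongrightarrow> t0" using real_Cauchy_convergent unfolding convergent_def by blast
      have "(\<lambda>n. x n - t n *\<^sub>R a) \<longlonglongrightarrow> l - t0 *\<^sub>R a"
        by (intro tendsto_diff tendsto_scaleR tendsto_const lim t0)
      then have "l - t0 *\<^sub>R a \<in> span E" by (rule closed_sequentially[OF insert.IH t])
      then show "l \<in> span (insert a E)" unfolding span_breakdown_eq by blast
    qed
  qed
qed simp

section \<open>The elliptic problem of a single time step\<close>

text \<open>
  All steps of the scheme have this shape: \<open>j\<close> is \<open>J\<close> with its first argument frozen at the known
  state, and the Lipschitz term and the load enter only through a fixed functional \<open>b\<close>.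
\<close>

locale elliptic_hemivariational =
  fixes A :: "'v::banach \<Rightarrow> 'v \<Rightarrow>\<^sub>L real" and j :: "'x::real_normed_vector \<Rightarrow> real"
    and \<gamma> :: "'v \<Rightarrow>\<^sub>L 'x" and m_A m :: real
  assumes A_linear: "bounded_linear A"
    and A_symmetric: "\<And>u v. blinfun_apply (A u) v = blinfun_apply (A v) u"
    and A_coercive: "\<And>u. blinfun_apply (A u) u \<ge> m_A * (norm u)\<^sup>2"
    and j_lipschitz: "locally_lipschitz j"
    and m_nonneg: "m \<ge> 0"
    and relaxed: "\<And>v1 v2. clarke_deriv j v1 (v2 - v1) + clarke_deriv j v2 (v1 - v2)
      \<le> ereal (m * (norm (v1 - v2))\<^sup>2)"
    and small: "m_A - m * (norm \<gamma>)\<^sup>2 > 0"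
begin

definition \<delta> :: real where "\<delta> = m_A - m * (norm \<gamma>)\<^sup>2"

lemma \<delta>_pos: "\<delta> > 0"
  using small by (simp add: \<delta>_def)

definition energy :: "('v \<Rightarrow>\<^sub>L real) \<Rightarrow> 'v \<Rightarrow> real" where
  "energy b w = 1 / 2 * blinfun_apply (A w) w + blinfun_apply b w + j (blinfun_apply \<gamma> w)"

lemma A_add: "A (x + y) = A x + A y" and A_scale: "A (s *\<^sub>R x) = s *\<^sub>R A x"
  and A_diff: "A (x - y) = A x - A y"
  using bounded_linear.linear[OF A_linear] by (blast intro: linear_add linear_scale linear_diff)+

lemma relaxed_image_bound: "m * (norm (blinfun_apply \<gamma> w))\<^sup>2 \<le> m * (norm \<gamma>)\<^sup>2 * (norm w)\<^sup>2"
proof -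
  have "(norm (blinfun_apply \<gamma> w))\<^sup>2 \<le> (norm \<gamma> * norm w)\<^sup>2"
    by (intro power_mono norm_blinfun) simp
  then have "m * (norm (blinfun_apply \<gamma> w))\<^sup>2 \<le> m * (norm \<gamma> * norm w)\<^sup>2"
    using m_nonneg by (rule mult_left_mono)
  then show ?thesis by (simp add: power_mult_distrib mult.assoc)
qed

text \<open>
  The coercivity of \<open>A\<close> outweighs the semiconvexity defect of \<open>j\<close>, so the energy is strongly
  convex in the sense of subgradients.
\<close>

lemma energy_growth:
  assumes \<zeta>: "\<zeta> \<in> clarke_subdiff j (blinfun_apply \<gamma> v)"
  shows "energy b v + blinfun_apply (A v + b + (\<zeta> o\<^sub>L \<gamma>)) (w - v) + \<delta> / 2 * (norm (w - v))\<^sup>2 \<le> energy b w"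
proof -
  define z where "z = w - v"
  have w: "w = v + z" by (simp add: z_def)
  have "j (\<gamma> v) + \<zeta> (\<gamma> z) - m / 2 * (norm (\<gamma> z))\<^sup>2 \<le> j (\<gamma> w)"
    using relaxed_monotone_lower_bound[OF j_lipschitz relaxed \<zeta>, of "\<gamma> w"]
    by (simp add: w blinfun.add_right)
  moreover have "m / 2 * (norm (\<gamma> z))\<^sup>2 \<le> m / 2 * (norm \<gamma>)\<^sup>2 * (norm z)\<^sup>2"
    using relaxed_image_bound[of z] by simp
  moreover have "1 / 2 * A w w = 1 / 2 * A v v + A v z + 1 / 2 * A z z"
    using A_symmetric[of z v] by (simp add: w A_add blinfun.add_left blinfun.add_right algebra_simps)
  moreover have "1 / 2 * A z z \<ge> m_A / 2 * (norm z)\<^sup>2" using A_coercive[of z] by simp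
  ultimately show ?thesis
    unfolding z_def[symmetric] energy_def
    by (simp add: \<delta>_def w blinfun.add_left blinfun.add_right algebra_simps diff_divide_distrib)
qed


text \<open>
  Only this half of the sum and chain rules holds for an arbitrary locally Lipschitz \<open>j\<close>: base points
  near \<open>v\<close> are mapped by \<open>\<gamma>\<close> to base points near \<open>\<gamma> v\<close>, but those need not exhaust a
  neighbourhood.
\<close>

lemma energy_clarke_deriv_le:
  "clarke_deriv (energy b) v z
    \<le> ereal (blinfun_apply (A v + b) z + clarke_real j (blinfun_apply \<gamma> v) (blinfun_apply \<gamma> z))"
  unfolding clarke_deriv_le_iff
proof (intro allI impI)
  fix e :: real assume e: "e > 0"
  have fst: "filterlim fst (nhds v) (nhds v \<times>\<^sub>F at_right (0::real))" by (rule filterlim_fst)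
  have "filterlim snd (at_right (0::real)) (nhds v \<times>\<^sub>F at_right 0)" by (rule filterlim_snd)
  then have snd: "(snd \<longlongrightarrow> (0::real)) (nhds v \<times>\<^sub>F at_right 0)" unfolding filterlim_at by blast
  have "((\<lambda>p. A (fst p) z + snd p / 2 * A z z) \<longlongrightarrow> A v z + 0 / 2 * A z z) (nhds v \<times>\<^sub>F at_right (0::real))"
    by (intro tendsto_intros bounded_linear.tendsto[OF A_linear] fst snd) simp
  then have quad: "\<forall>\<^sub>F p in nhds v \<times>\<^sub>F at_right (0::real). A (fst p) z + snd p / 2 * A z z < A v z + e / 2"
    by (rule order_tendstoD) (use e in simp)
  have "filterlim (\<lambda>p. (\<gamma> (fst p), snd p)) (nhds (\<gamma> v) \<times>\<^sub>F at_right 0) (nhds v \<times>\<^sub>F at_right (0::real))"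
    by (intro filterlim_Pair filterlim_snd blinfun.tendsto tendsto_const fst)
  moreover have "\<forall>\<^sub>F (y, t) in nhds (\<gamma> v) \<times>\<^sub>F at_right 0.
      j (y + t *\<^sub>R \<gamma> z) - j y \<le> (clarke_real j (\<gamma> v) (\<gamma> z) + e / 2) * t"
    using e by (intro clarke_real_increment[OF j_lipschitz]) simp
  ultimately have "\<forall>\<^sub>F p in nhds v \<times>\<^sub>F at_right (0::real). case (\<gamma> (fst p), snd p) of (y, t) \<Rightarrow>
      j (y + t *\<^sub>R \<gamma> z) - j y \<le> (clarke_real j (\<gamma> v) (\<gamma> z) + e / 2) * t"
    unfolding filterlim_iff by blast
  with quad eventually_snd_pos
  show "\<forall>\<^sub>F (y, t) in nhds v \<times>\<^sub>F at_right 0. energy b (y + t *\<^sub>R z) - energy b y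
      \<le> (blinfun_apply (A v + b) z + clarke_real j (\<gamma> v) (\<gamma> z) + e) * t"
  proof eventually_elim
    case (elim p)
    obtain y t where p: "p = (y, t)" by (cases p)
    have "t * (A y z + t / 2 * A z z) \<le> t * (A v z + e / 2)"
      using elim p by (intro mult_left_mono) auto
    moreover have "1 / 2 * A (y + t *\<^sub>R z) (y + t *\<^sub>R z) - 1 / 2 * A y y = t * (A y z + t / 2 * A z z)"
      using A_symmetric[of z y]
      by (simp add: A_add A_scale blinfun.add_left blinfun.add_right blinfun.scaleR_left
          blinfun.scaleR_right algebra_simps)
    ultimately show ?case
      using elim(3) unfolding p energy_def
      by (simp add: blinfun.add_left blinfun.add_right blinfun.scaleR_right algebra_simps)
  qed
qed

text \<open>
  Both the sum rule and the chain rule hold here with equality. The inclusion from left to right is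
  the Hahn-Banach extension of a subgradient along \<open>\<gamma>\<close>. The converse fails for general locally
  Lipschitz functions; it holds because the strong convexity estimate makes every functional on the
  right a global subgradient of the energy.
\<close>

lemma energy_subdiff:
  "clarke_subdiff (energy b) v
    = (\<lambda>\<zeta>. A v + b + (\<zeta> o\<^sub>L \<gamma>)) ` clarke_subdiff j (blinfun_apply \<gamma> v)"
proof (intro equalityI subsetI)
  fix \<xi> assume \<xi>: "\<xi> \<in> clarke_subdiff (energy b) v"
  have "ereal ((\<xi> - (A v + b)) z) \<le> clarke_deriv j (\<gamma> v) (\<gamma> z)" for z
  proof -
    have "ereal (\<xi> z) \<le> ereal ((A v + b) z + clarke_real j (\<gamma> v) (\<gamma> z))"
      using \<xi> energy_clarke_deriv_le[of b v z] unfolding clarke_subdiff_def by (blast intro: order_trans)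
    then show ?thesis
      by (simp add: clarke_deriv_eq_real[OF j_lipschitz] blinfun.diff_left algebra_simps)
  qed
  then obtain \<zeta> where \<zeta>: "\<zeta> \<in> clarke_subdiff j (\<gamma> v)" "\<And>z. \<zeta> (\<gamma> z) = (\<xi> - (A v + b)) z"
    using clarke_subgradient_extends[OF j_lipschitz subspace_UNIV, of "\<xi> - (A v + b)" "\<gamma> v" \<gamma>] by auto
  have "\<xi> = A v + b + (\<zeta> o\<^sub>L \<gamma>)"
    by (rule blinfun_eqI) (simp add: \<zeta>(2) blinfun.add_left blinfun.diff_left)
  then show "\<xi> \<in> (\<lambda>\<zeta>. A v + b + (\<zeta> o\<^sub>L \<gamma>)) ` clarke_subdiff j (\<gamma> v)" using \<zeta>(1) by blast
next
  fix \<xi> assume "\<xi> \<in> (\<lambda>\<zeta>. A v + b + (\<zeta> o\<^sub>L \<gamma>)) ` clarke_subdiff j (\<gamma> v)"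
  then obtain \<zeta> where \<zeta>: "\<zeta> \<in> clarke_subdiff j (\<gamma> v)" and \<xi>: "\<xi> = A v + b + (\<zeta> o\<^sub>L \<gamma>)" by blast
  show "\<xi> \<in> clarke_subdiff (energy b) v"
  proof (rule clarke_subdiffI)
    fix w
    have "0 \<le> \<delta> / 2 * (norm (w - v))\<^sup>2" using \<delta>_pos by simp
    then show "\<xi> (w - v) \<le> energy b w - energy b v"
      using energy_growth[OF \<zeta>, of b w] unfolding \<xi> by linarith
  qed
qed

lemma subgradients_relaxed_monotone:
  assumes "\<zeta>1 \<in> clarke_subdiff j x1" "\<zeta>2 \<in> clarke_subdiff j x2"
  shows "- (m * (norm (x1 - x2))\<^sup>2) \<le> blinfun_apply (\<zeta>1 - \<zeta>2) (x1 - x2)"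
proof -
  have "\<zeta>2 (x1 - x2) = - \<zeta>2 (x2 - x1)" by (simp add: blinfun.diff_right)
  moreover have "\<zeta>1 (x1 - x2) = - \<zeta>1 (x2 - x1)" by (simp add: blinfun.diff_right)
  ultimately show ?thesis
    using relaxed_monotone_lower_bound[OF j_lipschitz relaxed assms(1), of x2]
      relaxed_monotone_lower_bound[OF j_lipschitz relaxed assms(2), of x1]
    by (simp add: norm_minus_commute[of x2 x1] blinfun.diff_left)
qed

definition galerkin :: "'v set \<Rightarrow> ('v \<Rightarrow>\<^sub>L real) \<Rightarrow> 'v \<Rightarrow> bool" where
  "galerkin S b v \<longleftrightarrow> v \<in> S \<and>
    (\<exists>\<zeta>\<in>clarke_subdiff j (blinfun_apply \<gamma> v).
      \<forall>z\<in>S. blinfun_apply (A v) z + blinfun_apply b z + blinfun_apply \<zeta> (blinfun_apply \<gamma> z) = 0)"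

lemma galerkin_unique:
  assumes S: "subspace S" and "galerkin S b v1" "galerkin S b v2"
  shows "v1 = v2"
proof -
  define z where "z = v1 - v2"
  obtain \<zeta>1 \<zeta>2 where \<zeta>: "\<zeta>1 \<in> clarke_subdiff j (\<gamma> v1)" "\<zeta>2 \<in> clarke_subdiff j (\<gamma> v2)"
    and eq: "A v1 z + b z + \<zeta>1 (\<gamma> z) = 0" "A v2 z + b z + \<zeta>2 (\<gamma> z) = 0"
    using assms unfolding galerkin_def z_def by (meson subspace_diff)
  have "A z z + (\<zeta>1 - \<zeta>2) (\<gamma> z) = 0"
    using eq by (simp add: z_def A_diff blinfun.diff_left)
  moreover have "- (m * (norm (\<gamma> z))\<^sup>2) \<le> (\<zeta>1 - \<zeta>2) (\<gamma> z)"
    using subgradients_relaxed_monotone[OF \<zeta>] by (simp add: z_def blinfun.diff_right)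
  ultimately have "\<delta> * (norm z)\<^sup>2 \<le> 0"
    using A_coercive[of z] relaxed_image_bound[of z] by (simp add: \<delta>_def left_diff_distrib)
  then have "norm z = 0" using \<delta>_pos by (simp add: mult_le_0_iff)
  then show ?thesis by (simp add: z_def)
qed

text \<open>Testing with the solution itself and comparing its subgradient with one at the origin.\<close>

lemma galerkin_norm_bound:
  assumes "galerkin S b v" and \<zeta>0: "\<zeta>0 \<in> clarke_subdiff j 0"
  shows "\<delta> * norm v \<le> norm b + norm \<gamma> * norm \<zeta>0"
proof (cases "v = 0")
  case False
  obtain \<zeta> where \<zeta>: "\<zeta> \<in> clarke_subdiff j (\<gamma> v)" and eq: "A v v + b v + \<zeta> (\<gamma> v) = 0"
    using assms(1) unfolding galerkin_def by blast
  have "- (m * (norm (\<gamma> v))\<^sup>2) \<le> \<zeta> (\<gamma> v) - \<zeta>0 (\<gamma> v)"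
    using subgradients_relaxed_monotone[OF \<zeta> \<zeta>0] by (simp add: blinfun.diff_left)
  moreover have "- \<zeta>0 (\<gamma> v) \<le> norm \<zeta>0 * (norm \<gamma> * norm v)"
    using norm_blinfun[of \<zeta>0 "\<gamma> v"] mult_left_mono[OF norm_blinfun[of \<gamma> v] norm_ge_zero[of \<zeta>0]]
    unfolding real_norm_def by linarith
  moreover have "- b v \<le> norm b * norm v"
    using norm_blinfun[of b v] unfolding real_norm_def by linarith
  ultimately have "\<delta> * (norm v)\<^sup>2 \<le> norm b * norm v + norm \<zeta>0 * (norm \<gamma> * norm v)"
    using eq A_coercive[of v] relaxed_image_bound[of v] by (simp add: \<delta>_def left_diff_distrib)
  then have "(\<delta> * norm v) * norm v \<le> (norm b + norm \<gamma> * norm \<zeta>0) * norm v"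
    by (simp add: power2_eq_square algebra_simps)
  then show ?thesis using False by simp
qed simp

lemma energy_continuous: "continuous_on UNIV (energy b)"
proof -
  have 1: "continuous_on UNIV (\<lambda>w. j (\<gamma> w))"
    by (rule continuous_on_compose2[OF locally_lipschitz_continuous[OF j_lipschitz]])
      (auto intro!: continuous_intros)
  have 2: "continuous_on UNIV (\<lambda>w. A w w)"
    by (intro continuous_intros bounded_linear.continuous_on[OF A_linear])
  have 3: "continuous_on UNIV (\<lambda>w. b w)" by (intro continuous_intros)
  show ?thesis
    unfolding energy_def[abs_def]
    by (rule continuous_on_add[OF continuous_on_add[OF continuous_on_mult[OF continuous_on_const 2] 3] 1])
qed

lemma energy_bounded_below: "\<exists>l. \<forall>w. l \<le> energy b w"
proof -
  obtain \<zeta> where \<zeta>: "\<zeta> \<in> clarke_subdiff j (\<gamma> 0)" using clarke_subdiff_nonempty[OF j_lipschitz] by blast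
  define \<xi> where "\<xi> = A 0 + b + (\<zeta> o\<^sub>L \<gamma>)"
  have "energy b 0 - (norm \<xi>)\<^sup>2 / (2 * \<delta>) \<le> energy b w" for w
  proof -
    have "0 \<le> (\<delta> * norm w - norm \<xi>)\<^sup>2 / (2 * \<delta>)" using \<delta>_pos by simp
    also have "\<dots> = \<delta> / 2 * (norm w)\<^sup>2 - norm \<xi> * norm w + (norm \<xi>)\<^sup>2 / (2 * \<delta>)"
      using \<delta>_pos by (simp add: power2_eq_square field_simps)
    finally have "norm \<xi> * norm w - \<delta> / 2 * (norm w)\<^sup>2 \<le> (norm \<xi>)\<^sup>2 / (2 * \<delta>)" by simp
    moreover have "energy b 0 + \<xi> w + \<delta> / 2 * (norm w)\<^sup>2 \<le> energy b w"
      using energy_growth[OF \<zeta>, of b w] by (simp add: \<xi>_def)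
    moreover have "- (norm \<xi> * norm w) \<le> \<xi> w"
      using norm_blinfun[of \<xi> w] unfolding real_norm_def by linarith
    ultimately show ?thesis by linarith
  qed
  then show ?thesis by blast
qed

text \<open>
  The subgradient terms at the midpoint cancel, since its two endpoints lie in opposite directions.
\<close>

lemma energy_midpoint:
  "energy b ((1/2) *\<^sub>R (w1 + w2)) + \<delta> / 8 * (norm (w1 - w2))\<^sup>2 \<le> (energy b w1 + energy b w2) / 2"
proof -
  define c where "c = (1/2) *\<^sub>R (w1 + w2)"
  obtain \<zeta> where \<zeta>: "\<zeta> \<in> clarke_subdiff j (\<gamma> c)" using clarke_subdiff_nonempty[OF j_lipschitz] by blast
  define \<xi> where "\<xi> = A c + b + (\<zeta> o\<^sub>L \<gamma>)"
  define d where "d = (1/2) *\<^sub>R (w1 - w2)"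
  have "w1 = c + (1/2) *\<^sub>R (w1 - w2)" "w2 = c - (1/2) *\<^sub>R (w1 - w2)"
    by (simp_all add: c_def algebra_simps flip: scaleR_add_left)
  then have w: "w1 - c = d" "w2 - c = - d" by (simp_all add: d_def algebra_simps)
  define D where "D = \<delta> / 8 * (norm (w1 - w2))\<^sup>2"
  have D: "\<delta> / 2 * (norm d)\<^sup>2 = D" by (simp add: d_def D_def power_divide)
  have "energy b c + \<xi> d + D \<le> energy b w1" "energy b c - \<xi> d + D \<le> energy b w2"
    using energy_growth[OF \<zeta>, of b w1] energy_growth[OF \<zeta>, of b w2]
    unfolding \<xi>_def[symmetric] w norm_minus_cancel D by (simp_all add: blinfun.minus_right)
  then show ?thesis unfolding c_def[symmetric] D_def[symmetric] by simp
qed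

text \<open>
  Strong convexity makes the sublevel sets of the energy shrink to a point as the level approaches
  the infimum, so completeness of the space yields a minimizer.
\<close>

lemma energy_attains_min:
  assumes S: "subspace S" and closed: "closed S"
  obtains v where "v \<in> S" "\<And>w. w \<in> S \<Longrightarrow> energy b v \<le> energy b w"
proof -
  define I where "I = (INF w\<in>S. energy b w)"
  have bdd: "bdd_below (energy b ` S)" using energy_bounded_below[of b] by (auto intro: bdd_belowI)
  have I_le: "I \<le> energy b w" if "w \<in> S" for w
    unfolding I_def by (rule cINF_lower[OF bdd that])
  define Q where "Q n = S \<inter> energy b -` {..I + 1 / real (Suc n)}" for n
  obtain v where v: "\<And>n. v \<in> Q n"
  proof (rule decreasing_closed_nest[of Q])
    show "closed (Q n)" for n
      unfolding Q_def using closed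
      by (intro continuous_closed_preimage continuous_on_subset[OF energy_continuous]) auto
    show "Q n \<noteq> {}" for n
    proof -
      have "(INF w\<in>S. energy b w) < I + 1 / real (Suc n)" by (simp add: I_def)
      moreover have "S \<noteq> {}" using subspace_0[OF S] by blast
      ultimately obtain w where "w \<in> S" "energy b w < I + 1 / real (Suc n)"
        using cINF_less_iff[OF _ bdd] by blast
      then have "w \<in> Q n" by (simp add: Q_def)
      then show ?thesis by blast
    qed
    show "Q n \<subseteq> Q l" if "l \<le> n" for l n
    proof -
      have "1 / real (Suc n) \<le> 1 / real (Suc l)" using that by (simp add: frac_le)
      then show ?thesis by (auto simp: Q_def)
    qed
    fix e :: real assume e: "e > 0"
    then have "0 < \<delta> / 8 * e\<^sup>2" using \<delta>_pos by simp
    then obtain n where n: "1 / real (Suc n) < \<delta> / 8 * e\<^sup>2"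
      using nat_approx_posE by metis
    have "dist w1 w2 < e" if w: "w1 \<in> Q n" "w2 \<in> Q n" for w1 w2
    proof -
      have "(1/2) *\<^sub>R (w1 + w2) \<in> S" using w S by (simp add: Q_def subspace_add subspace_scale)
      then have "I \<le> energy b ((1/2) *\<^sub>R (w1 + w2))" by (rule I_le)
      moreover have "energy b w1 \<le> I + 1 / real (Suc n)" "energy b w2 \<le> I + 1 / real (Suc n)"
        using w by (auto simp: Q_def)
      ultimately have "\<delta> / 8 * (norm (w1 - w2))\<^sup>2 \<le> 1 / real (Suc n)"
        using energy_midpoint[of b w1 w2] by simp
      then have "\<delta> / 8 * (norm (w1 - w2))\<^sup>2 < \<delta> / 8 * e\<^sup>2" using n by linarith
      then have "(norm (w1 - w2))\<^sup>2 < e\<^sup>2" using \<delta>_pos by simp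
      then show ?thesis using e by (simp add: dist_norm power_less_imp_less_base)
    qed
    then show "\<exists>n. \<forall>x\<in>Q n. \<forall>y\<in>Q n. dist x y < e" by blast
  qed blast
  have "energy b v \<le> I"
  proof (rule field_le_epsilon)
    fix e :: real assume "e > 0"
    then obtain n where "1 / real (Suc n) < e" using nat_approx_posE by metis
    then show "energy b v \<le> I + e" using v[of n] by (simp add: Q_def)
  qed
  then show ?thesis using that[of v] v[of 0] I_le by (force simp: Q_def)
qed

text \<open>
  Minimality over \<open>S\<close> only controls directional derivatives in directions of \<open>S\<close>; the Hahn-Banach
  extension turns this into a subgradient of \<open>j\<close> on the whole space satisfying the equation when
  tested with \<open>S\<close>.
\<close>

lemma galerkin_exists:
  assumes S: "subspace S" and closed: "closed S"
  obtains v where "galerkin S b v"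
proof -
  obtain v where v: "v \<in> S" and min: "\<And>w. w \<in> S \<Longrightarrow> energy b v \<le> energy b w"
    using energy_attains_min[OF assms] by metis
  have "ereal ((- (A v + b)) z) \<le> clarke_deriv j (\<gamma> v) (\<gamma> z)" if z: "z \<in> S" for z
  proof -
    have "ereal 0 \<le> clarke_deriv (energy b) v z"
      by (intro clarke_deriv_ge always_eventually allI)
        (use min v z S in \<open>simp add: subspace_add subspace_scale\<close>)
    also note energy_clarke_deriv_le
    finally show ?thesis
      by (simp add: clarke_deriv_eq_real[OF j_lipschitz] blinfun.minus_left blinfun.add_left
          blinfun.diff_left)
  qed
  then obtain \<zeta> where "\<zeta> \<in> clarke_subdiff j (\<gamma> v)" "\<And>z. z \<in> S \<Longrightarrow> \<zeta> (\<gamma> z) = (- (A v + b)) z"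
    using clarke_subgradient_extends[OF j_lipschitz S, of "- (A v + b)" "\<gamma> v" \<gamma>] by blast
  then show ?thesis
    using v unfolding galerkin_def by (intro that[unfolded galerkin_def] conjI bexI[of _ \<zeta>])
      (auto simp: blinfun.add_left blinfun.minus_left blinfun.diff_left)
qed

end

section \<open>Marching in time\<close>

text \<open>
  The bracket bounding \<open>x j\<close> grows by at most the factor \<open>1 + q\<close> per step, so it is the bracket, and
  not \<open>x\<close> itself, that carries the induction.
\<close>

lemma discrete_gronwall:
  fixes x :: "nat \<Rightarrow> real"
  assumes step: "\<And>j. 1 \<le> j \<Longrightarrow> j \<le> N \<Longrightarrow> x j \<le> a + q * (\<Sum>i=1..j-1. x i)"
    and q: "q \<ge> 0" and a: "a \<ge> 0" and j: "1 \<le> j" "j \<le> N"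
  shows "x j \<le> a * exp (q * real N)"
proof -
  have "a + q * (\<Sum>i=1..n. x i) \<le> a * (1 + q) ^ n" if "n < N" for n
    using that
  proof (induction n)
    case (Suc n)
    let ?s = "a + q * (\<Sum>i=1..n. x i)"
    have "a + q * (\<Sum>i=1..Suc n. x i) = ?s + q * x (Suc n)" by (simp add: algebra_simps)
    also have "\<dots> \<le> ?s + q * ?s" using step[of "Suc n"] Suc.prems q by (simp add: mult_left_mono)
    also have "\<dots> = ?s * (1 + q)" by (simp add: algebra_simps)
    also have "\<dots> \<le> (a * (1 + q) ^ n) * (1 + q)" using Suc q by (intro mult_right_mono) auto
    finally show ?case by (simp add: mult_ac)
  qed simp
  from this[of "j - 1"] have "x j \<le> a * (1 + q) ^ (j - 1)" using step[of j] j by force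
  also have "\<dots> \<le> a * (1 + q) ^ N" using j q a by (intro mult_left_mono power_increasing) auto
  also have "\<dots> \<le> a * exp q ^ N" using q a by (intro mult_left_mono power_mono exp_ge_add_one_self) auto
  also have "exp q ^ N = exp (q * real N)" by (simp add: exp_of_nat2_mult)
  finally show ?thesis .
qed

text \<open>
  The state entering step \<open>j\<close> involves only earlier velocities, so unique solvability of the single
  steps propagates through the recursion.
\<close>

lemma explicit_scheme_unique_solution:
  fixes G :: "nat \<Rightarrow> 'v::real_vector \<Rightarrow> 'v \<Rightarrow> bool"
  assumes ex1: "\<And>j u. \<exists>!v. G j u v"
  shows "\<exists>!v. v \<in> extensional {1..N} \<and> (\<forall>j\<in>{1..N}. G j (discrete_K k u0h v (j - 1)) (v j))"
proof (rule ex_ex1I)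
  define s where "s j u = (THE v. G j u v)" for j u
  have s: "G j u (s j u)" for j u unfolding s_def by (rule theI'[OF ex1])
  define U where "U = rec_nat u0h (\<lambda>i u. u + k *\<^sub>R s (Suc i) u)"
  define v where "v = (\<lambda>j\<in>{1..N}. s j (U (j - 1)))"
  have K: "discrete_K k u0h v n = U n" if "n \<le> N" for n
    using that
  proof (induction n)
    case (Suc n)
    have "v (Suc n) = s (Suc n) (U n)" using Suc.prems by (simp add: v_def)
    then show ?case using Suc by (simp add: discrete_K_def U_def algebra_simps)
  qed (simp add: discrete_K_def U_def)
  have "G j (discrete_K k u0h v (j - 1)) (v j)" if "j \<in> {1..N}" for j
    using that s[of j "U (j - 1)"] K[of "j - 1"] by (auto simp: v_def)
  then show "\<exists>v. v \<in> extensional {1..N} \<and> (\<forall>j\<in>{1..N}. G j (discrete_K k u0h v (j - 1)) (v j))"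
    by (intro exI[of _ v]) (auto simp: v_def)
next
  fix v v'
  assume v: "v \<in> extensional {1..N} \<and> (\<forall>j\<in>{1..N}. G j (discrete_K k u0h v (j - 1)) (v j))"
    and v': "v' \<in> extensional {1..N} \<and> (\<forall>j\<in>{1..N}. G j (discrete_K k u0h v' (j - 1)) (v' j))"
  have "v j = v' j" if "j \<in> {1..N}" for j
    using that
  proof (induction j rule: less_induct)
    case (less j)
    have "discrete_K k u0h v (j - 1) = discrete_K k u0h v' (j - 1)"
      unfolding discrete_K_def using less by (auto intro!: sum.cong)
    then show ?case using ex1 v v' less.prems by metis
  qed
  then show "v = v'" using v v' by (meson extensionalityI)
qed

section \<open>The fully discrete scheme\<close>

theorem theorem7:
  fixes A B :: "'v::banach \<Rightarrow> 'v \<Rightarrow>\<^sub>L real"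
    and J :: "'x::banach \<Rightarrow> 'x \<Rightarrow> real"
    and \<gamma> :: "'v \<Rightarrow>\<^sub>L 'x"
    and f :: "real \<Rightarrow> 'v \<Rightarrow>\<^sub>L real"
    and u0 :: 'v
    and T m_A L_B c0 c1 c2 m_J1 m_J2 :: real
  assumes V_reflexive: "reflexive_space TYPE('v)"
    and T_pos: "T > 0"
    and A_linear: "bounded_linear A"
    and A_symmetric: "\<And>u v. blinfun_apply (A u) v = blinfun_apply (A v) u"
    and m_A_pos: "m_A > 0"
    and A_coercive: "\<And>u. blinfun_apply (A u) u \<ge> m_A * (norm u)\<^sup>2"
    and L_B_pos: "L_B > 0"
    and B_lipschitz: "\<And>v w. norm (B v - B w) \<le> L_B * norm (v - w)"
    and J_loc_lipschitz: "\<And>w. locally_lipschitz (J w)"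
    and c_nonneg: "c0 \<ge> 0" "c1 \<ge> 0" "c2 \<ge> 0"
    and J_growth: "\<And>w v \<xi>. \<xi> \<in> clarke_subdiff (J w) v \<Longrightarrow>
          norm \<xi> \<le> c0 + c1 * norm w + c2 * norm v"
    and m_J_nonneg: "m_J1 \<ge> 0" "m_J2 \<ge> 0"
    and J_relaxed: "\<And>w1 w2 v1 v2.
          clarke_deriv (J w1) v1 (v2 - v1) + clarke_deriv (J w2) v2 (v1 - v2)
            \<le> ereal (m_J1 * (norm (v1 - v2))\<^sup>2 + m_J2 * norm (w1 - w2) * norm (v1 - v2))"
    and f_continuous: "continuous_on {0..T} f"
    and smallness: "m_A - 2 * m_J1 * (norm \<gamma>)\<^sup>2 > 0"
  shows "\<forall>R. \<exists>c>0. \<forall>Vh u0h N.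
    finite_dim_subspace Vh \<and> u0h \<in> Vh \<and> norm (u0h - u0) \<le> R \<and> N \<ge> 1 \<longrightarrow>
      (\<forall>v. incl_solution UNIV A B J \<gamma> f T Vh u0h N v \<longleftrightarrow> opt_solution UNIV A B J \<gamma> f T Vh u0h N v) \<and>
      (\<forall>v. incl_solution Vh A B J \<gamma> f T Vh u0h N v \<longleftrightarrow> opt_solution Vh A B J \<gamma> f T Vh u0h N v) \<and>
      (\<exists>!v. incl_solution Vh A B J \<gamma> f T Vh u0h N v) \<and>
      (\<forall>v. incl_solution Vh A B J \<gamma> f T Vh u0h N v \<longrightarrow>
        (\<forall>j\<in>{1..N}. norm (v j) \<le> c * (1 + norm (f (real j * (T / real N))))))"
proof (intro allI)
  fix R :: real
  have step: "elliptic_hemivariational A (J w) \<gamma> m_A m_J1" for w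
  proof (rule elliptic_hemivariational.intro)
    show "clarke_deriv (J w) v1 (v2 - v1) + clarke_deriv (J w) v2 (v1 - v2)
        \<le> ereal (m_J1 * (norm (v1 - v2))\<^sup>2)" for v1 v2
      using J_relaxed[of w v1 v2 w] by simp
    have "m_J1 * (norm \<gamma>)\<^sup>2 \<ge> 0" using m_J_nonneg by simp
    then show "0 < m_A - m_J1 * (norm \<gamma>)\<^sup>2" using smallness by linarith
  qed (rule A_linear A_symmetric A_coercive J_loc_lipschitz m_J_nonneg)+
  have functional: "step_functional A B J \<gamma> g u
      = elliptic_hemivariational.energy A (J (\<gamma> u)) \<gamma> (B u - g)" for g u
    by (rule ext) (simp add: step_functional_def elliptic_hemivariational.energy_def[OF step])

  \<comment> \<open>The left-hand sides of the inclusion, minus the load, are exactly the subgradients of the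
    step functional, so it does not matter on which test space they are required to vanish.\<close>
  have incl_opt: "incl_solution W A B J \<gamma> f T Vh u0h N v \<longleftrightarrow> opt_solution W A B J \<gamma> f T Vh u0h N v"
    for W Vh u0h N v
  proof -
    have "(\<exists>\<zeta>\<in>clarke_subdiff (J (\<gamma> u)) (\<gamma> x). eq_on_test W (A x + B u + (\<zeta> o\<^sub>L \<gamma>)) g) \<longleftrightarrow>
        (\<exists>\<xi>\<in>clarke_subdiff (step_functional A B J \<gamma> g u) x. eq_on_test W 0 \<xi>)" for u x g
      unfolding functional elliptic_hemivariational.energy_subdiff[OF step] bex_simps(7) eq_on_test_def
      by (intro bex_cong ball_cong refl) (auto simp: blinfun.add_left blinfun.diff_left)
    then show ?thesis unfolding incl_solution_def opt_solution_def Let_def by simp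
  qed

  define G where "G Vh k j u x \<longleftrightarrow>
      elliptic_hemivariational.galerkin A (J (\<gamma> u)) \<gamma> Vh (B u - f (real j * k)) x"
    for Vh and k :: real and j :: nat and u x
  have incl_G: "incl_solution Vh A B J \<gamma> f T Vh u0h N v \<longleftrightarrow> v \<in> extensional {1..N} \<and>
      (\<forall>j\<in>{1..N}. G Vh (T / real N) j (discrete_K (T / real N) u0h v (j - 1)) (v j))" for Vh u0h N v
  proof -
    have "(A x + B u + (\<zeta> o\<^sub>L \<gamma>)) z = g z \<longleftrightarrow> A x z + (B u - g) z + \<zeta> (\<gamma> z) = 0" for x u \<zeta> z and g :: "'v \<Rightarrow>\<^sub>L real"
      by (auto simp: blinfun.add_left blinfun.diff_left)
    then show ?thesis
      unfolding incl_solution_def G_def elliptic_hemivariational.galerkin_def[OF step] eq_on_test_def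
        Let_def PiE_def Pi_def
      by auto
  qed

  \<comment> \<open>One step gives \<open>d \<parallel>v\<^sub>j\<parallel> \<le> const + \<beta> \<parallel>u\<parallel>\<close> with \<open>u\<close> the known state; \<open>M\<close> bounds the initial
    state, \<open>F\<close> the loads, and \<open>a\<close> collects what enters the Gronwall inequality as a constant. The
    summand \<open>1\<close> only makes \<open>c\<close> strictly positive.\<close>
  have "\<exists>F. \<forall>t\<in>{0..T}. norm (f t) \<le> F"
    using compact_imp_bounded[OF compact_continuous_image[OF f_continuous compact_Icc]]
    by (simp add: bounded_iff)
  then obtain F where F: "\<And>t. t \<in> {0..T} \<Longrightarrow> norm (f t) \<le> F" by blast
  define d where "d = m_A - m_J1 * (norm \<gamma>)\<^sup>2"
  define \<beta> where "\<beta> = L_B + c1 * (norm \<gamma>)\<^sup>2"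
  define M where "M = norm u0 + \<bar>R\<bar>"
  define a where "a = (norm (B 0) + F + norm \<gamma> * c0 + \<beta> * M) / d"
  define c where "c = a * exp (\<beta> / d * T) + 1"
  have d: "d > 0" using elliptic_hemivariational.small[OF step] by (simp add: d_def)
  have \<beta>: "\<beta> \<ge> 0" using L_B_pos c_nonneg by (simp add: \<beta>_def)
  have "norm (f 0) \<le> F" using F[of 0] T_pos by simp
  then have "F \<ge> 0" using norm_ge_zero[of "f 0"] by linarith
  then have a: "a \<ge> 0" using d \<beta> c_nonneg by (simp add: a_def M_def)
  then have c: "c > 0" by (simp add: c_def add_nonneg_pos)

  \<comment> \<open>The bound on \<open>B\<close> and the growth of the subdifferential are both affine in the known state.\<close>
  have one_step: "d * norm x \<le> norm (B 0) + F + norm \<gamma> * c0 + \<beta> * norm u"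
    if G: "G Vh k j u x" and t: "real j * k \<in> {0..T}" for Vh k j u x
  proof -
    obtain \<zeta> where \<zeta>: "\<zeta> \<in> clarke_subdiff (J (\<gamma> u)) 0"
      using clarke_subdiff_nonempty[OF J_loc_lipschitz] by blast
    have "d * norm x \<le> norm (B u - f (real j * k)) + norm \<gamma> * norm \<zeta>"
      using elliptic_hemivariational.galerkin_norm_bound[OF step G[unfolded G_def] \<zeta>]
      by (simp add: elliptic_hemivariational.\<delta>_def[OF step] d_def)
    moreover have "norm (B u - f (real j * k)) \<le> norm (B 0) + norm (B u - B 0) + norm (f (real j * k))"
      using norm_triangle_ineq4[of "B u" "f (real j * k)"] norm_triangle_ineq2[of "B u" "B 0"] by linarith
    moreover have "norm (B u - B 0) \<le> L_B * norm u" using B_lipschitz[of u 0] by simp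
    moreover have "norm (f (real j * k)) \<le> F" using F t by blast
    moreover have "norm \<gamma> * norm \<zeta> \<le> norm \<gamma> * (c0 + c1 * (norm \<gamma> * norm u))"
    proof (rule mult_left_mono)
      have "norm \<zeta> \<le> c0 + c1 * norm (\<gamma> u)" using J_growth[OF \<zeta>] by simp
      also have "\<dots> \<le> c0 + c1 * (norm \<gamma> * norm u)"
        using norm_blinfun c_nonneg by (intro add_left_mono mult_left_mono) auto
      finally show "norm \<zeta> \<le> c0 + c1 * (norm \<gamma> * norm u)" .
    qed simp
    moreover have "norm \<gamma> * (c0 + c1 * (norm \<gamma> * norm u)) + L_B * norm u = norm \<gamma> * c0 + \<beta> * norm u"
      by (simp add: \<beta>_def power2_eq_square algebra_simps)
    ultimately show ?thesis by linarith
  qed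

  have main: "(\<exists>!v. incl_solution Vh A B J \<gamma> f T Vh u0h N v) \<and>
      (\<forall>v. incl_solution Vh A B J \<gamma> f T Vh u0h N v \<longrightarrow>
        (\<forall>j\<in>{1..N}. norm (v j) \<le> c * (1 + norm (f (real j * (T / real N))))))"
    if Vh: "finite_dim_subspace Vh" and u0h: "norm (u0h - u0) \<le> R" and N: "N \<ge> 1" for Vh u0h N
  proof (intro conjI allI impI ballI)
    define k where "k = T / real N"
    have k: "k > 0" "k * real N = T" using T_pos N by (simp_all add: k_def)
    obtain E where "finite E" and E: "Vh = span E"
      using Vh unfolding finite_dim_subspace_def by blast
    then have S: "subspace Vh" "closed Vh"
      unfolding E by (simp_all add: closed_span_finite)
    have "\<exists>!x. G Vh k j u x" for j u
      using elliptic_hemivariational.galerkin_exists[OF step S]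
        elliptic_hemivariational.galerkin_unique[OF step S(1)] unfolding G_def by metis
    then show "\<exists>!v. incl_solution Vh A B J \<gamma> f T Vh u0h N v"
      unfolding incl_G k_def[symmetric] by (rule explicit_scheme_unique_solution)
    fix v j assume "incl_solution Vh A B J \<gamma> f T Vh u0h N v" and j: "j \<in> {1..N}"
    then have v: "G Vh k i (discrete_K k u0h v (i - 1)) (v i)" if "i \<in> {1..N}" for i
      using that unfolding incl_G k_def by blast
    have "norm (v j) \<le> a * exp (\<beta> / d * k * real N)"
    proof (rule discrete_gronwall[where x = "\<lambda>i. norm (v i)"])
      fix i assume i: "1 \<le> i" "i \<le> N"
      have "real i * k \<le> real N * k" using i k by (intro mult_right_mono) auto
      then have "real i * k \<in> {0..T}" using k by (simp add: mult.commute)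
      from one_step[OF v this] i
      have 1: "d * norm (v i) \<le> norm (B 0) + F + norm \<gamma> * c0 + \<beta> * norm (discrete_K k u0h v (i - 1))"
        by simp
      have "norm u0h \<le> M" using u0h norm_triangle_ineq2[of u0h u0] by (simp add: M_def)
      moreover have "norm (k *\<^sub>R (\<Sum>l=1..i-1. v l)) \<le> k * (\<Sum>l=1..i-1. norm (v l))"
        using k by (simp add: norm_sum mult_left_mono)
      ultimately have K: "norm (discrete_K k u0h v (i - 1)) \<le> M + k * (\<Sum>l=1..i-1. norm (v l))"
        unfolding discrete_K_def using norm_triangle_ineq[of "k *\<^sub>R (\<Sum>l=1..i-1. v l)" u0h] by linarith
      have "d * norm (v i) \<le> norm (B 0) + F + norm \<gamma> * c0 + \<beta> * (M + k * (\<Sum>l=1..i-1. norm (v l)))"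
        using 1 mult_left_mono[OF K \<beta>] by linarith
      then have "norm (v i) \<le> (norm (B 0) + F + norm \<gamma> * c0 + \<beta> * (M + k * (\<Sum>l=1..i-1. norm (v l)))) / d"
        using d by (simp add: pos_le_divide_eq mult.commute)
      also have "\<dots> = a + \<beta> / d * k * (\<Sum>l=1..i-1. norm (v l))"
        by (simp add: a_def distrib_left add_divide_distrib)
      finally show "norm (v i) \<le> a + \<beta> / d * k * (\<Sum>l=1..i-1. norm (v l))" .
    qed (use \<beta> d k a j in auto)
    also have "\<dots> \<le> c" using k(2) by (simp add: c_def mult.assoc)
    also have "\<dots> \<le> c * (1 + norm (f (real j * (T / real N))))" using c by (simp add: distrib_left)
    finally show "norm (v j) \<le> c * (1 + norm (f (real j * (T / real N))))" .
  qed
  show "\<exists>c>0. \<forall>Vh u0h N.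
    finite_dim_subspace Vh \<and> u0h \<in> Vh \<and> norm (u0h - u0) \<le> R \<and> N \<ge> 1 \<longrightarrow>
      (\<forall>v. incl_solution UNIV A B J \<gamma> f T Vh u0h N v \<longleftrightarrow> opt_solution UNIV A B J \<gamma> f T Vh u0h N v) \<and>
      (\<forall>v. incl_solution Vh A B J \<gamma> f T Vh u0h N v \<longleftrightarrow> opt_solution Vh A B J \<gamma> f T Vh u0h N v) \<and>
      (\<exists>!v. incl_solution Vh A B J \<gamma> f T Vh u0h N v) \<and>
      (\<forall>v. incl_solution Vh A B J \<gamma> f T Vh u0h N v \<longrightarrow>
        (\<forall>j\<in>{1..N}. norm (v j) \<le> c * (1 + norm (f (real j * (T / real N))))))"
  proof (intro exI[of _ c] conjI[OF c] allI impI, elim conjE, goal_cases)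
    case (1 Vh u0h N)
    from main[OF 1(1,3,4)] show ?case
      by (rule conjI[OF allI[OF incl_opt] conjI[OF allI[OF incl_opt]]])
  qed
qed

end
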